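(* Let $d\ge1$, let $\alpha=(\alpha_1,\dots,\alpha_d)\in\mathbb{C}^d$ be non-resonant (its components are linearly independent over $\mathbb{Q}$), and let $$F=\sum_{i=1}^d(\alpha_i+\omega_i)p_iq_i+O(3)\in R=SD_\alpha[[\tau,q,p]].$$ Then there exists a Poisson automorphism $\Phi\in\mathrm{Aut}(R)$ such that $$\Phi(F)=\sum_{i=1}^d(\alpha_i+\omega_i)p_iq_i+T,\qquad T\in M.$$
   Context: Variables: $q=(q_1,\dots,q_d)$, $p=(p_1,\dots,p_d)$, $\tau=(\tau_1,\dots,\tau_d)$, $\omega=(\omega_1,\dots,\omega_d)$. With $(x,y)=\sum_ix_iy_i$, the small denominator ring is $SD_\alpha:=\mathbb{C}\big[\omega,\tfrac{1}{(\alpha+\omega,J)}: J\in\mathbb{Z}^d\setminus\{0\}\big]\subset\mathbb{C}(\omega)$, and $R:=SD_\alpha[[\tau,q,p]]$. The Poisson bracket on $R$ is $\{f,g\}=\sum_{i=1}^d\big(\partial_{q_i}f\,\partial_{p_i}g-\partial_{p_i}f\,\partial_{q_i}g\big)$; its Poisson centre is $R_0:=SD_\alpha[[\tau]]$. A Poisson automorphism of $R$ is a $\mathbb{C}$-algebra automorphism preserving the bracket (it need not fix $\omega$). Weights: $q_i,p_i$ have weight $1$, $\tau_i$ has weight $2$, $\omega_i$ (and elements of $SD_\alpha$) have weight $0$. $O(3)$ denotes an element of $R$ all of whose monomials have weight $\ge 3$. Put $f_i=p_iq_i-\tau_i$ and $I=\langle f_1,\dots,f_d\rangle\subset R$ (ideal);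 $R_0[[f]]=R_0[[f_1,\dots,f_d]]\subset R$ is the subalgebra of power series in the $f_i$ with coefficients in $R_0$. The Moser algebra is $M:=R_0+\big(I^2\cap R_0[[f]]\big)$. *)

theory Defs
  imports
    Complex_Main
    "HOL-Library.Poly_Mapping"
    "HOL-Computational_Algebra.Fraction_Field"
    "HOL-Algebra.Ideal_Product"
    "HOL-Algebra.QuotRing"
begin

section \<open>Multivariate formal power series\<close>

text \<open>Power series over the coefficient ring \<open>'a\<close> in variables indexed by \<open>'v\<close>: arbitrary functions
  on the exponent vectors \<open>'v \<Rightarrow>\<^sub>0 nat\<close>, with the convolution product.\<close>

typedef ('v, 'a) mps = "UNIV :: (('v \<Rightarrow>\<^sub>0 nat) \<Rightarrow> 'a) set"
  morphisms mps_coeff Abs_mps ..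

setup_lifting type_definition_mps

lemma mps_eqI: "(\<And>k. mps_coeff f k = mps_coeff g k) \<Longrightarrow> f = g"
  by (metis ext mps_coeff_inject)

lemma finite_poly_mapping_below:
  fixes k :: "'v \<Rightarrow>\<^sub>0 nat"
  shows "finite {a. \<forall>v. Poly_Mapping.lookup a v \<le> Poly_Mapping.lookup k v}"
proof -
  let ?S = "{f :: 'v \<Rightarrow> nat. f \<in> (Poly_Mapping.keys k \<rightarrow>\<^sub>E UNIV) \<and> (\<forall>v. v \<in> Poly_Mapping.keys k \<longrightarrow> f v \<le> Poly_Mapping.lookup k v)}"
  have eq: "?S = PiE (Poly_Mapping.keys k) (\<lambda>v. {..Poly_Mapping.lookup k v})"
    by (auto simp: PiE_def Pi_def)
  have "finite ?S"
    unfolding eq by (intro finite_PiE) auto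
  moreover have "inj_on (\<lambda>a. restrict (Poly_Mapping.lookup a) (Poly_Mapping.keys k)) {a. \<forall>v. Poly_Mapping.lookup a v \<le> Poly_Mapping.lookup k v}"
  proof (rule inj_onI, rule poly_mapping_eqI)
    fix a b v
    assume a: "a \<in> {a. \<forall>v. Poly_Mapping.lookup a v \<le> Poly_Mapping.lookup k v}" and b: "b \<in> {a. \<forall>v. Poly_Mapping.lookup a v \<le> Poly_Mapping.lookup k v}"
      and r: "restrict (Poly_Mapping.lookup a) (Poly_Mapping.keys k) = restrict (Poly_Mapping.lookup b) (Poly_Mapping.keys k)"
    show "Poly_Mapping.lookup a v = Poly_Mapping.lookup b v"
    proof (cases "v \<in> Poly_Mapping.keys k")
      case True
      then show ?thesis using fun_cong[OF r, of v] by simp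
    next
      case False
      then have "Poly_Mapping.lookup k v = 0" by (simp add: in_keys_iff)
      then show ?thesis using a b by (metis (mono_tags, lifting) le_zero_eq mem_Collect_eq)
    qed
  qed
  moreover have "(\<lambda>a. restrict (Poly_Mapping.lookup a) (Poly_Mapping.keys k)) ` {a. \<forall>v. Poly_Mapping.lookup a v \<le> Poly_Mapping.lookup k v} \<subseteq> ?S"
    by auto
  ultimately show ?thesis
    by (meson finite_imageD finite_subset)
qed

lemma finite_antidiagonal:
  fixes k :: "'v \<Rightarrow>\<^sub>0 nat"
  shows "finite {(a, b). a + b = k}"
proof -
  let ?B = "{a. \<forall>v. Poly_Mapping.lookup a v \<le> Poly_Mapping.lookup k v}"
  have "{(a, b). a + b = k} \<subseteq> ?B \<times> ?B"
    by (auto simp: lookup_add)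
  then show ?thesis
    using finite_poly_mapping_below[of k] by (meson finite_SigmaI finite_subset)
qed

lemma finite_antidiagonal' [simp]:
  fixes k :: "'v \<Rightarrow>\<^sub>0 nat"
  shows "finite {x. fst x + snd x = k}"
  using finite_antidiagonal[of k] by (simp add: case_prod_unfold)

instantiation mps :: (type, comm_ring_1) comm_ring_1
begin

lift_definition zero_mps :: "('a, 'b) mps" is "\<lambda>k. 0" .
lift_definition one_mps :: "('a, 'b) mps" is "\<lambda>k. if k = 0 then 1 else 0" .
lift_definition plus_mps :: "('a, 'b) mps \<Rightarrow> ('a, 'b) mps \<Rightarrow> ('a, 'b) mps"
  is "\<lambda>f g k. f k + g k" .
lift_definition minus_mps :: "('a, 'b) mps \<Rightarrow> ('a, 'b) mps \<Rightarrow> ('a, 'b) mps"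
  is "\<lambda>f g k. f k - g k" .
lift_definition uminus_mps :: "('a, 'b) mps \<Rightarrow> ('a, 'b) mps"
  is "\<lambda>f k. - f k" .
lift_definition times_mps :: "('a, 'b) mps \<Rightarrow> ('a, 'b) mps \<Rightarrow> ('a, 'b) mps"
  is "\<lambda>f g k. \<Sum>(a, b) \<in> {(a, b). a + b = k}. f a * g b" .

instance
proof
  fix f g h :: "('a, 'b) mps"
  show "f + g + h = f + (g + h)" by transfer (simp add: fun_eq_iff ac_simps)
  show "f + g = g + f" by transfer (simp add: fun_eq_iff ac_simps)
  show "0 + f = f" by transfer simp
  show "- f + f = 0" by transfer simp
  show "f - g = f + - g" by transfer simp
  show "(0 :: ('a, 'b) mps) \<noteq> 1" by transfer (metis zero_neq_one)
  show "(f + g) * h = f * h + g * h"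
    by transfer (simp add: fun_eq_iff case_prod_unfold distrib_right sum.distrib)
  show "1 * f = f"
  proof transfer
    fix f :: "('a \<Rightarrow>\<^sub>0 nat) \<Rightarrow> 'b"
    have "(\<Sum>(a, b) \<in> {(a, b). a + b = k}. (if a = 0 then 1 else 0) * f b) = f k" for k
    proof -
      have "(\<Sum>(a, b) \<in> {(a, b). a + b = k}. (if a = 0 then 1 else 0) * f b)
          = (\<Sum>(a, b) \<in> {(0 :: 'a \<Rightarrow>\<^sub>0 nat, k)}. (if a = 0 then 1 else 0) * f b)"
        proof (rule sum.mono_neutral_right)
          show "finite {(a, b). a + b = k}" by (rule finite_antidiagonal)
        qed (auto split: if_splits)
      then show ?thesis by simp
    qed
    then show "(\<lambda>k. \<Sum>(a, b) \<in> {(a, b). a + b = k}. (if a = 0 then 1 else 0) * f b) = f" ..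
  qed
  show "f * g = g * f"
  proof transfer
    fix f g :: "('a \<Rightarrow>\<^sub>0 nat) \<Rightarrow> 'b"
    have "(\<Sum>(a, b) \<in> {(a, b). a + b = k}. f a * g b)
        = (\<Sum>(a, b) \<in> {(a, b). a + b = k}. g a * f b)" for k
      by (rule sum.reindex_bij_witness[of _ prod.swap prod.swap]) (auto simp: ac_simps)
    then show "(\<lambda>k. \<Sum>(a, b) \<in> {(a, b). a + b = k}. f a * g b)
        = (\<lambda>k. \<Sum>(a, b) \<in> {(a, b). a + b = k}. g a * f b)" ..
  qed
  show "f * g * h = f * (g * h)"
  proof transfer
    fix f g h :: "('a \<Rightarrow>\<^sub>0 nat) \<Rightarrow> 'b"
    have "(\<Sum>(a, b) \<in> {(a, b). a + b = k}. (\<Sum>(c, d) \<in> {(c, d). c + d = a}. f c * g d) * h b)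
        = (\<Sum>(a, b) \<in> {(a, b). a + b = k}. f a * (\<Sum>(c, d) \<in> {(c, d). c + d = b}. g c * h d))"
      (is "?L = ?R") for k
    proof -
      have "?L = (\<Sum>x \<in> {x. fst x + snd x = k}. \<Sum>y \<in> {y. fst y + snd y = fst x}.
          f (fst y) * g (snd y) * h (snd x))"
        by (simp add: case_prod_unfold sum_distrib_right)
      also have "\<dots> = (\<Sum>(x, y) \<in> (SIGMA x:{x. fst x + snd x = k}. {y. fst y + snd y = fst x}).
          f (fst y) * g (snd y) * h (snd x))"
        by (rule sum.Sigma) auto
      also have "\<dots> = (\<Sum>(x, y) \<in> (SIGMA x:{x. fst x + snd x = k}. {y. fst y + snd y = snd x}).
          f (fst x) * (g (fst y) * h (snd y)))"
        by (rule sum.reindex_bij_witness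
            [of _ "\<lambda>(x, y). ((fst x + fst y, snd y), (fst x, fst y))"
                  "\<lambda>(x, y). ((fst y, snd y + snd x), (snd y, snd x))"])
          (auto simp: ac_simps)
      also have "\<dots> = (\<Sum>x \<in> {x. fst x + snd x = k}. \<Sum>y \<in> {y. fst y + snd y = snd x}.
          f (fst x) * (g (fst y) * h (snd y)))"
        by (rule sum.Sigma[symmetric]) auto
      also have "\<dots> = ?R"
        by (simp add: case_prod_unfold sum_distrib_left)
      finally show ?thesis .
    qed
    then show "(\<lambda>k. \<Sum>(a, b) \<in> {(a, b). a + b = k}. (\<Sum>(c, d) \<in> {(c, d). c + d = a}. f c * g d) * h b)
        = (\<lambda>k. \<Sum>(a, b) \<in> {(a, b). a + b = k}. f a * (\<Sum>(c, d) \<in> {(c, d). c + d = b}. g c * h d))" ..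
  qed
qed

end

lift_definition mps_const :: "'a::zero \<Rightarrow> ('v, 'a) mps" is "\<lambda>c k. if k = 0 then c else 0" .

lift_definition mps_var :: "'v \<Rightarrow> ('v, 'a::zero_neq_one) mps"
  is "\<lambda>v k. if k = Poly_Mapping.single v 1 then 1 else 0" .

lift_definition mps_deriv :: "'v \<Rightarrow> ('v, 'a::semiring_1) mps \<Rightarrow> ('v, 'a) mps"
  is "\<lambda>v f k. of_nat (Poly_Mapping.lookup k v + 1) * f (k + Poly_Mapping.single v 1)" .

definition has_formal_sum :: "('i \<Rightarrow> ('v, 'a::comm_monoid_add) mps) \<Rightarrow> ('v, 'a) mps \<Rightarrow> bool" where
  "has_formal_sum g s \<longleftrightarrow> (\<forall>m. finite {i. mps_coeff (g i) m \<noteq> 0} \<and>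
     mps_coeff s m = (\<Sum>i | mps_coeff (g i) m \<noteq> 0. mps_coeff (g i) m))"


section \<open>The small denominator ring\<close>

text \<open>The dimension is the cardinality of the index type \<open>'d\<close>. The field \<open>\<complex>(\<omega>)\<close> is the fraction
  field of the polynomial ring \<open>('d \<Rightarrow>\<^sub>0 nat) \<Rightarrow>\<^sub>0 complex\<close>; the linear order on \<open>'d\<close> serves only to
  obtain the library's integral domain instance for polynomials.\<close>

type_synonym 'd ratfun = "(('d \<Rightarrow>\<^sub>0 nat) \<Rightarrow>\<^sub>0 complex) fract"

definition scalar :: "complex \<Rightarrow> 'd::{finite,linorder} ratfun" where
  "scalar c = Fract (Poly_Mapping.single 0 c) 1"

definition omega :: "'d::{finite,linorder} \<Rightarrow> 'd ratfun" where
  "omega i = Fract (Poly_Mapping.single (Poly_Mapping.single i 1) 1) 1"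

definition nonresonant :: "('d::finite \<Rightarrow> complex) \<Rightarrow> bool" where
  "nonresonant \<alpha> \<longleftrightarrow> (\<forall>r :: 'd \<Rightarrow> rat. (\<Sum>i\<in>UNIV. of_rat (r i) * \<alpha> i) = 0 \<longrightarrow> (\<forall>i. r i = 0))"

inductive_set SD :: "('d::{finite,linorder} \<Rightarrow> complex) \<Rightarrow> 'd ratfun set"
  for \<alpha> :: "'d \<Rightarrow> complex" where
  scalar: "scalar c \<in> SD \<alpha>"
| omega: "omega i \<in> SD \<alpha>"
| small_denominator: "J \<noteq> (\<lambda>i. 0 :: int) \<Longrightarrow>
    1 / (\<Sum>i\<in>UNIV. (scalar (\<alpha> i) + omega i) * of_int (J i)) \<in> SD \<alpha>"
| add: "x \<in> SD \<alpha> \<Longrightarrow> y \<in> SD \<alpha> \<Longrightarrow> x + y \<in> SD \<alpha>"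
| mult: "x \<in> SD \<alpha> \<Longrightarrow> y \<in> SD \<alpha> \<Longrightarrow> x * y \<in> SD \<alpha>"


section \<open>The Poisson algebra\<close>

datatype 'd var = TauVar 'd | QVar 'd | PVar 'd

type_synonym 'd series = "('d var, 'd ratfun) mps"

text \<open>The ring \<open>R\<close> is the subring of \<open>\<complex>(\<omega>)[[\<tau>, q, p]]\<close> of series with coefficients in \<open>SD \<alpha>\<close>.\<close>

definition ring_R :: "('d::{finite,linorder} \<Rightarrow> complex) \<Rightarrow> 'd series ring" where
  "ring_R \<alpha> = \<lparr>carrier = {f. \<forall>k. mps_coeff f k \<in> SD \<alpha>}, mult = (*), one = 1, zero = 0, add = (+)\<rparr>"

definition ring_R0 :: "('d::{finite,linorder} \<Rightarrow> complex) \<Rightarrow> 'd series set" where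
  "ring_R0 \<alpha> = {f \<in> carrier (ring_R \<alpha>). \<forall>k. mps_coeff f k \<noteq> 0 \<longrightarrow> Poly_Mapping.keys k \<subseteq> range TauVar}"

definition poisson_bracket ::
    "'d::{finite,linorder} series \<Rightarrow> 'd series \<Rightarrow> 'd series" where
  "poisson_bracket f g = (\<Sum>i\<in>UNIV.
     mps_deriv (QVar i) f * mps_deriv (PVar i) g - mps_deriv (PVar i) f * mps_deriv (QVar i) g)"

definition poisson_automorphism ::
    "('d::{finite,linorder} \<Rightarrow> complex) \<Rightarrow> ('d series \<Rightarrow> 'd series) \<Rightarrow> bool" where
  "poisson_automorphism \<alpha> \<Phi> \<longleftrightarrow>
     \<Phi> \<in> ring_iso (ring_R \<alpha>) (ring_R \<alpha>) \<and>
     (\<forall>c. \<forall>f \<in> carrier (ring_R \<alpha>). \<Phi> (mps_const (scalar c) * f) = mps_const (scalar c) * \<Phi> f) \<and>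
     (\<forall>f \<in> carrier (ring_R \<alpha>). \<forall>g \<in> carrier (ring_R \<alpha>).
        \<Phi> (poisson_bracket f g) = poisson_bracket (\<Phi> f) (\<Phi> g))"

fun var_weight :: "'d var \<Rightarrow> nat" where
  "var_weight (TauVar i) = 2"
| "var_weight (QVar i) = 1"
| "var_weight (PVar i) = 1"

definition weight :: "('d var \<Rightarrow>\<^sub>0 nat) \<Rightarrow> nat" where
  "weight k = (\<Sum>v\<in>Poly_Mapping.keys k. Poly_Mapping.lookup k v * var_weight v)"

definition bigO :: "('d::{finite,linorder} \<Rightarrow> complex) \<Rightarrow> nat \<Rightarrow> 'd series set" where
  "bigO \<alpha> n = {f \<in> carrier (ring_R \<alpha>). \<forall>k. mps_coeff f k \<noteq> 0 \<longrightarrow> weight k \<ge> n}"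

definition H0 :: "('d::{finite,linorder} \<Rightarrow> complex) \<Rightarrow> 'd series" where
  "H0 \<alpha> = (\<Sum>i\<in>UNIV. mps_const (scalar (\<alpha> i) + omega i) * mps_var (PVar i) * mps_var (QVar i))"


section \<open>The Moser algebra\<close>

text \<open>\<open>moser_gen i\<close> is \<open>f\<^sub>i = p\<^sub>i q\<^sub>i - \<tau>\<^sub>i\<close>, \<open>moser_ideal \<alpha>\<close> is \<open>I\<close>, and
  \<open>R0_moser_gens \<alpha>\<close> is \<open>R\<^sub>0[[f]]\<close>. Every family \<open>c\<^sub>k f\<^sup>k\<close> has a formal sum, because no \<open>f\<^sub>i\<close>
  has a constant term.\<close>

definition moser_gen :: "'d::{finite,linorder} \<Rightarrow> 'd series" where
  "moser_gen i = mps_var (PVar i) * mps_var (QVar i) - mps_var (TauVar i)"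

definition moser_ideal :: "('d::{finite,linorder} \<Rightarrow> complex) \<Rightarrow> 'd series set" where
  "moser_ideal \<alpha> = Idl\<^bsub>ring_R \<alpha>\<^esub> (range moser_gen)"

definition R0_moser_gens :: "('d::{finite,linorder} \<Rightarrow> complex) \<Rightarrow> 'd series set" where
  "R0_moser_gens \<alpha> = {s. \<exists>c :: ('d \<Rightarrow>\<^sub>0 nat) \<Rightarrow> 'd series. (\<forall>k. c k \<in> ring_R0 \<alpha>) \<and>
     has_formal_sum (\<lambda>k. c k * (\<Prod>i\<in>UNIV. moser_gen i ^ Poly_Mapping.lookup k i)) s}"

definition moser_algebra :: "('d::{finite,linorder} \<Rightarrow> complex) \<Rightarrow> 'd series set" where
  "moser_algebra \<alpha> = {a + b | a b. a \<in> ring_R0 \<alpha> \<and>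
     b \<in> (moser_ideal \<alpha> \<cdot>\<^bsub>ring_R \<alpha>\<^esub> moser_ideal \<alpha>) \<inter> R0_moser_gens \<alpha>}"


section \<open>Well-formedness\<close>

text \<open>\<open>ring_R \<alpha>\<close> is a commutative ring containing the \<open>f\<^sub>i\<close>, so that the generated ideal and its square
  have their usual meaning.\<close>

lemma scalar_0: "scalar 0 = 0" and scalar_1: "scalar 1 = 1"
  by (simp_all add: scalar_def Zero_fract_def One_fract_def)

lemma SD_0: "0 \<in> SD \<alpha>" and SD_1: "1 \<in> SD \<alpha>"
  using SD.scalar[of 0 \<alpha>] SD.scalar[of 1 \<alpha>] by (simp_all add: scalar_0 scalar_1)

lemma SD_uminus:
  assumes "x \<in> SD \<alpha>"
  shows "- x \<in> SD \<alpha>"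
proof -
  have "scalar (- 1) = (- 1 :: 'a ratfun)"
    by (simp add: scalar_def One_fract_def single_uminus)
  then show ?thesis
    using SD.mult[OF SD.scalar[of "- 1" \<alpha>] assms] by simp
qed

lemma SD_sum: "(\<And>i. i \<in> A \<Longrightarrow> f i \<in> SD \<alpha>) \<Longrightarrow> sum f A \<in> SD \<alpha>"
  by (induction A rule: infinite_finite_induct) (auto intro: SD_0 SD.add)

lemma small_denominator_nonzero:
  fixes \<alpha> :: "'d::{finite,linorder} \<Rightarrow> complex"
  assumes "J \<noteq> (\<lambda>i. 0 :: int)"
  shows "(\<Sum>i\<in>UNIV. (scalar (\<alpha> i) + omega i) * of_int (J i)) \<noteq> 0"
proof -
  let ?p = "\<lambda>i. (Poly_Mapping.single 0 (\<alpha> i) + Poly_Mapping.single (Poly_Mapping.single i 1) 1)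
      * Poly_Mapping.single 0 (of_int (J i)) :: ('d \<Rightarrow>\<^sub>0 nat) \<Rightarrow>\<^sub>0 complex"
  have int: "of_int n = Fract (Poly_Mapping.single 0 (of_int n)) (1 :: ('d \<Rightarrow>\<^sub>0 nat) \<Rightarrow>\<^sub>0 complex)" for n
  proof (induction n rule: int_induct[where k = 0])
    case base
    then show ?case by (simp add: Zero_fract_def)
  next
    case (step1 i)
    then show ?case by (simp add: One_fract_def single_add)
  next
    case (step2 i)
    then show ?case by (simp add: One_fract_def single_diff)
  qed
  have sum: "sum (\<lambda>i. Fract (?p i) 1) A = Fract (sum ?p A) 1" for A :: "'d set"
    by (induction A rule: infinite_finite_induct) (auto simp: Zero_fract_def)
  have "(\<Sum>i\<in>UNIV. (scalar (\<alpha> i) + omega i) * of_int (J i)) = Fract (sum ?p UNIV) 1"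
    unfolding sum[symmetric] by (simp add: scalar_def omega_def int)
  moreover obtain j where j: "J j \<noteq> 0" using assms by blast
  have "Poly_Mapping.lookup (sum ?p UNIV) (Poly_Mapping.single j 1)
      = (\<Sum>i\<in>UNIV. if i = j then of_int (J j) else 0)"
    unfolding lookup_sum
  proof (rule sum.cong)
    fix i :: 'd
    have "Poly_Mapping.single i 1 = Poly_Mapping.single j (1::nat) \<longleftrightarrow> i = j"
      by (metis lookup_single_eq lookup_single_not_eq zero_neq_one)
    moreover have "Poly_Mapping.single j (1::nat) \<noteq> 0"
      by (metis lookup_single_eq lookup_zero zero_neq_one)
    moreover have "Poly_Mapping.single 0 c * Poly_Mapping.single 0 m
        = Poly_Mapping.single (0 :: 'd \<Rightarrow>\<^sub>0 nat) (c * m)"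
      "Poly_Mapping.single (Poly_Mapping.single i 1) 1 * Poly_Mapping.single 0 m
        = Poly_Mapping.single (Poly_Mapping.single i (1::nat)) m" for c m :: complex
      by (simp_all only: mult_single add_0_left add_0_right mult_1_left)
    ultimately show "Poly_Mapping.lookup (?p i) (Poly_Mapping.single j 1)
        = (if i = j then of_int (J j) else 0)"
      by (simp only: distrib_right lookup_add lookup_single when_def simp_thms) auto
  qed simp
  then have "sum ?p UNIV \<noteq> 0"
    using j by auto
  ultimately show ?thesis
    by (simp add: Zero_fract_def eq_fract)
qed

lemma cring_R: "cring (ring_R \<alpha>)"
proof (rule cringI)
  show "abelian_group (ring_R \<alpha>)"
  proof (rule abelian_groupI)
    fix x assume "x \<in> carrier (ring_R \<alpha>)"
    then show "\<exists>y \<in> carrier (ring_R \<alpha>). y \<oplus>\<^bsub>ring_R \<alpha>\<^esub> x = \<zero>\<^bsub>ring_R \<alpha>\<^esub>"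
      by (intro bexI[of _ "- x"]) (auto simp: ring_R_def uminus_mps.rep_eq intro: SD_uminus)
  qed (auto simp: ring_R_def plus_mps.rep_eq zero_mps.rep_eq ac_simps intro: SD_0 SD.add)
  show "comm_monoid (ring_R \<alpha>)"
    by (rule comm_monoidI)
      (auto simp: ring_R_def times_mps.rep_eq one_mps.rep_eq ac_simps
        intro!: SD_0 SD_1 SD_sum SD.mult)
qed (auto simp: ring_R_def distrib_right)

lemma moser_gen_in_R: "moser_gen i \<in> carrier (ring_R \<alpha>)"
proof -
  have v: "mps_coeff (mps_var w) k \<in> SD \<alpha>" for w k
    by (auto simp: mps_var.rep_eq SD_0 SD_1)
  have "mps_coeff (moser_gen i) k \<in> SD \<alpha>" for k
    unfolding moser_gen_def minus_mps.rep_eq times_mps.rep_eq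
    unfolding diff_conv_add_uminus
    by (intro SD.add SD_uminus SD_sum v) (auto intro: SD.mult v)
  then show ?thesis by (simp add: ring_R_def)
qed

end

theory Submission
  imports Defs
begin

text \<open>
  Filter \<open>R\<close> by weight and write \<open>F = H0 + G\<close>. Two kinds of Poisson derivations are used: the Hamiltonian
  ones \<open>{\<cdot>, S}\<close>, and \<open>\<Sum> a\<^sub>i \<partial>/\<partial>\<omega>\<^sub>i\<close> with \<open>a\<^sub>i\<close> in the Poisson centre. On a monomial, \<open>{H0, \<cdot>}\<close> is
  multiplication by a small denominator \<open>(\<alpha> + \<omega>, J)\<close>, where \<open>J\<close> is the difference of the exponents of \<open>p\<close>
  and \<open>q\<close>; hence the first kind removes all monomials with \<open>J \<noteq> 0\<close>. What remains is a series in \<open>\<tau>\<close> and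
  \<open>p\<^sub>i q\<^sub>i = f\<^sub>i + \<tau>\<^sub>i\<close>, so it lies in \<open>R\<^sub>0[[f]]\<close>, and its part linear in \<open>f\<close> is removed by the second kind,
  which maps \<open>H0\<close> to \<open>\<Sum> a\<^sub>i p\<^sub>i q\<^sub>i\<close>.

  Instead of composing infinitely many exponentials, the automorphism is built as one path-ordered
  exponential \<open>\<Phi> = \<Sum> \<Phi>\<^sub>n\<close>, where \<open>n \<Phi>\<^sub>n = \<Sum>\<^sub>k \<Phi>\<^sub>n\<^sub>-\<^sub>k D\<^sub>k\<close> for Poisson derivations \<open>D\<^sub>k\<close> raising the weight by
  \<open>k\<close>. The Leibniz rule for the \<open>D\<^sub>k\<close> makes \<open>\<Phi>\<close> multiplicative for the product and for the bracket, and
  \<open>D\<^sub>n\<close> is chosen recursively from the homological equation, so as to bring the part of degree \<open>n\<close> of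
  \<open>\<Phi> F\<close> into normal form.
\<close>

section \<open>Differentiation with respect to the frequencies\<close>

text \<open>The coefficient formula is that of \<open>mps_deriv\<close>. The support stays finite
  because shifting exponents is injective.\<close>

lift_definition poly_deriv :: "'v \<Rightarrow> (('v \<Rightarrow>\<^sub>0 nat) \<Rightarrow>\<^sub>0 'a) \<Rightarrow> ('v \<Rightarrow>\<^sub>0 nat) \<Rightarrow>\<^sub>0 'a::comm_semiring_1"
  is "\<lambda>v p k. of_nat (Poly_Mapping.lookup k v + 1) * p (k + Poly_Mapping.single v 1)"
proof -
  fix v :: 'v and p :: "('v \<Rightarrow>\<^sub>0 nat) \<Rightarrow> 'a"
  assume "finite {k. p k \<noteq> 0}"
  then have "finite ((\<lambda>k. k + Poly_Mapping.single v 1) -` {k. p k \<noteq> 0})"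
    by (rule finite_vimageI) (simp add: inj_on_def)
  then show "finite {k. of_nat (Poly_Mapping.lookup k v + 1) * p (k + Poly_Mapping.single v 1) \<noteq> 0}"
    by (rule rev_finite_subset) auto
qed

lemma poly_deriv_add: "poly_deriv v (p + q) = poly_deriv v p + poly_deriv v q"
  by (rule poly_mapping_eqI) (simp add: poly_deriv.rep_eq lookup_add algebra_simps)

lemma poly_deriv_zero [simp]: "poly_deriv v 0 = 0"
  by (rule poly_mapping_eqI) (simp add: poly_deriv.rep_eq)

text \<open>Subtraction of exponent vectors is truncated, so it inverts the shift only where the
  exponent of \<open>v\<close> is nonzero. The derivative rules rest on this case
  distinction.\<close>

lemma add_single_eq_iff:
  fixes a k :: "'v \<Rightarrow>\<^sub>0 nat"
  shows "k + Poly_Mapping.single v 1 = a \<longleftrightarrow> Poly_Mapping.lookup a v \<noteq> 0 \<and> k = a - Poly_Mapping.single v 1"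
proof
  assume "k + Poly_Mapping.single v 1 = a"
  then show "Poly_Mapping.lookup a v \<noteq> 0 \<and> k = a - Poly_Mapping.single v 1"
    by (auto simp: lookup_add)
next
  assume *: "Poly_Mapping.lookup a v \<noteq> 0 \<and> k = a - Poly_Mapping.single v 1"
  show "k + Poly_Mapping.single v 1 = a"
  proof (rule poly_mapping_eqI)
    fix w
    show "Poly_Mapping.lookup (k + Poly_Mapping.single v 1) w = Poly_Mapping.lookup a w"
      using * by (cases "w = v") (auto simp: lookup_add lookup_minus lookup_single)
  qed
qed

lemma poly_deriv_single:
  "poly_deriv v (Poly_Mapping.single a c)
     = Poly_Mapping.single (a - Poly_Mapping.single v 1) (of_nat (Poly_Mapping.lookup a v) * c)"
proof (rule poly_mapping_eqI)
  fix k
  show "Poly_Mapping.lookup (poly_deriv v (Poly_Mapping.single a c)) k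
      = Poly_Mapping.lookup (Poly_Mapping.single (a - Poly_Mapping.single v 1) (of_nat (Poly_Mapping.lookup a v) * c)) k"
  proof (cases "k + Poly_Mapping.single v 1 = a")
    case True
    then have "Poly_Mapping.lookup a v = Poly_Mapping.lookup k v + 1" by (auto simp: lookup_add)
    then show ?thesis using True
      by (auto simp: poly_deriv.rep_eq lookup_single)
  next
    case False
    then have "Poly_Mapping.lookup a v = 0 \<or> k \<noteq> a - Poly_Mapping.single v 1"
      using add_single_eq_iff[of k v a] by blast
    then show ?thesis using False
      by (auto simp: poly_deriv.rep_eq lookup_single when_def)
  qed
qed

lemma poly_deriv_mult_single:
  "poly_deriv v (Poly_Mapping.single a c * Poly_Mapping.single b e)
     = poly_deriv v (Poly_Mapping.single a c) * Poly_Mapping.single b e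
       + Poly_Mapping.single a c * poly_deriv v (Poly_Mapping.single b e)"
proof -
  let ?e = "Poly_Mapping.single v (1::nat)"
  have 1: "Poly_Mapping.lookup x v \<noteq> 0 \<Longrightarrow> x - ?e + y = x + y - ?e" for x y
  proof -
    assume "Poly_Mapping.lookup x v \<noteq> 0"
    then have "x - ?e + ?e = x" using add_single_eq_iff[of "x - ?e" v x] by simp
    then have "x + y = (x - ?e + y) + ?e" by (simp add: ac_simps)
    then show ?thesis by simp
  qed
  \<comment> \<open>If \<open>a\<close> lacks the variable \<open>v\<close>, truncation may make the
    two exponents differ, but then the coefficient has the factor 0.\<close>
  have "Poly_Mapping.single (a - ?e + b) (of_nat (Poly_Mapping.lookup a v) * c * e)
      = Poly_Mapping.single (a + b - ?e) (of_nat (Poly_Mapping.lookup a v) * c * e)"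
    using 1[of a b] by (cases "Poly_Mapping.lookup a v = 0") auto
  moreover have "Poly_Mapping.single (a + (b - ?e)) (c * (of_nat (Poly_Mapping.lookup b v) * e))
      = Poly_Mapping.single (a + b - ?e) (c * (of_nat (Poly_Mapping.lookup b v) * e))"
    using 1[of b a] by (cases "Poly_Mapping.lookup b v = 0") (auto simp: add.commute)
  ultimately show ?thesis
    by (simp add: mult_single poly_deriv_single lookup_add single_add[symmetric] algebra_simps)
qed

text \<open>Updating at a fresh key is adding a monomial. In this additive form the induction
  reduces bilinear identities to products of two monomials.\<close>

lemma poly_mapping_add_single_induct [case_names zero single_add]:
  fixes p :: "'a \<Rightarrow>\<^sub>0 'b::comm_monoid_add"
  assumes zero: "P 0"
    and add: "\<And>a c q. P q \<Longrightarrow> P (Poly_Mapping.single a c + q)"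
  shows "P p"
proof (induction p rule: Poly_Mapping.update_induct)
  case (update f a b)
  have "Poly_Mapping.update a b f = Poly_Mapping.single a b + f"
    using update by (intro poly_mapping_eqI)
      (auto simp: update.rep_eq lookup_add lookup_single when_def in_keys_iff)
  then show ?case using update add by simp
qed (rule zero)

lemma poly_deriv_mult: "poly_deriv v (p * q) = poly_deriv v p * q + p * poly_deriv v q"
proof (induction p rule: poly_mapping_add_single_induct)
  case (single_add a c p)
  have "poly_deriv v (Poly_Mapping.single a c * q)
      = poly_deriv v (Poly_Mapping.single a c) * q + Poly_Mapping.single a c * poly_deriv v q"
    by (induction q rule: poly_mapping_add_single_induct)
      (simp_all add: poly_deriv_mult_single poly_deriv_add distrib_left distrib_right
        add.assoc add.left_commute)
  with single_add show ?case by (simp only: poly_deriv_add distrib_right add.assoc add.left_commute)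
qed simp

section \<open>The quotient rule on the field of rational functions\<close>

text \<open>The second hypothesis is the derivative of the first. Together they make the quotient
  rule independent of the chosen fraction.\<close>

lemma quotient_rule_cong:
  fixes p q :: "'a::idom"
  assumes "p * q' = p' * q" and "dp * q' + p * dq' = dp' * q + p' * dq"
  shows "(dp' * q' - p' * dq') * (q * q) = (dp * q - p * dq) * (q' * q')"
proof -
  have "(dp' * q' - p' * dq') * (q * q) - (dp * q - p * dq) * (q' * q')
      = q * q' * (dp' * q + p' * dq - (dp * q' + p * dq')) + (q' * dq + q * dq') * (p * q' - p' * q)"
    by (simp add: algebra_simps)
  then show ?thesis using assms by simp
qed

text \<open>Both sides are the numerator of the derivative of a/b + c/d over the common denominator
  (b d)^2.\<close>

lemma quotient_rule_add:
  fixes a b :: "'a::idom"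
  shows "(da * d + a * dd + (dc * b + c * db)) * (b * d) - (a * d + c * b) * (db * d + b * dd)
    = (da * b - a * db) * (d * d) + (dc * d - c * dd) * (b * b)"
  by (simp add: algebra_simps)

text \<open>The product rule for (a/b) (c/d), cross-multiplied: one side has the denominator (b
  d)^2, the other the product of b^2 d and b d^2.\<close>

lemma quotient_rule_mult:
  fixes a b :: "'a::idom"
  shows "((da * c + a * dc) * (b * d) - (a * c) * (db * d + b * dd)) * ((b * b * d) * (b * (d * d)))
    = ((da * b - a * db) * c * (b * (d * d)) + a * (dc * d - c * dd) * (b * b * d)) * ((b * d) * (b * d))"
proof -
  let ?u = "b * d"
  have "(da * c + a * dc) * ?u - (a * c) * (db * d + b * dd)
      = (da * b - a * db) * (c * d) + a * (dc * d - c * dd) * b"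
    by (simp add: algebra_simps)
  moreover have "b * b * d * (b * (d * d)) = ?u * (?u * ?u)"
    by (simp only: ac_simps)
  moreover have "(da * b - a * db) * c * (b * (d * d)) + a * (dc * d - c * dd) * (b * b * d)
      = ((da * b - a * db) * (c * d) + a * (dc * d - c * dd) * b) * ?u"
    by (simp only: distrib_right distrib_left ac_simps)
  ultimately show ?thesis by (simp only: mult.assoc)
qed

text \<open>The description ranges over all fractions representing \<open>x\<close>; that it has a
  unique solution is the well-definedness of the quotient rule.\<close>

definition fract_deriv :: "'d \<Rightarrow> 'd::{finite,linorder} ratfun \<Rightarrow> 'd ratfun" where
  "fract_deriv i x = (THE y. \<exists>p q. q \<noteq> 0 \<and> x = Fract p q \<and>
     y = Fract (poly_deriv i p * q - p * poly_deriv i q) (q * q))"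

lemma fract_deriv_Fract:
  assumes q: "q \<noteq> 0"
  shows "fract_deriv i (Fract p q) = Fract (poly_deriv i p * q - p * poly_deriv i q) (q * q)"
  unfolding fract_deriv_def
proof (rule the_equality)
  show "\<exists>p' q'. q' \<noteq> 0 \<and> Fract p q = Fract p' q' \<and>
      Fract (poly_deriv i p * q - p * poly_deriv i q) (q * q)
        = Fract (poly_deriv i p' * q' - p' * poly_deriv i q') (q' * q')"
    using q by blast
next
  fix y
  assume "\<exists>p' q'. q' \<noteq> 0 \<and> Fract p q = Fract p' q' \<and>
      y = Fract (poly_deriv i p' * q' - p' * poly_deriv i q') (q' * q')"
  then obtain p' q' where q': "q' \<noteq> 0" and "Fract p q = Fract p' q'"
    and y: "y = Fract (poly_deriv i p' * q' - p' * poly_deriv i q') (q' * q')" by blast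
  then have e: "p * q' = p' * q" using q by (simp add: eq_fract)
  \<comment> \<open>Differentiating the cross-multiplied equality \<open>e\<close> supplies the
    second premise of \<open>quotient_rule_cong\<close>.\<close>
  then have "poly_deriv i p * q' + p * poly_deriv i q' = poly_deriv i p' * q + p' * poly_deriv i q"
    by (metis poly_deriv_mult)
  from e this have "(poly_deriv i p' * q' - p' * poly_deriv i q') * (q * q)
      = (poly_deriv i p * q - p * poly_deriv i q) * (q' * q')"
    by (rule quotient_rule_cong)
  then show "y = Fract (poly_deriv i p * q - p * poly_deriv i q) (q * q)"
    using q q' by (simp add: y eq_fract)
qed

lemma fract_deriv_add: "fract_deriv i (x + y) = fract_deriv i x + fract_deriv i y"
proof -
  obtain a b where x: "x = Fract a b" "b \<noteq> 0" by (cases x) auto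
  obtain c d where y: "y = Fract c d" "d \<noteq> 0" by (cases y) auto
  show ?thesis
    using x y by (simp add: fract_deriv_Fract poly_deriv_mult poly_deriv_add eq_fract quotient_rule_add)
qed

lemma fract_deriv_mult: "fract_deriv i (x * y) = fract_deriv i x * y + x * fract_deriv i y"
proof -
  obtain a b where x: "x = Fract a b" "b \<noteq> 0" by (cases x) auto
  obtain c d where y: "y = Fract c d" "d \<noteq> 0" by (cases y) auto
  have bd: "b * d \<noteq> 0" "b * b * d \<noteq> 0" "b * (d * d) \<noteq> 0"
    "b * d * (b * d) \<noteq> 0" "b * b * d * (b * (d * d)) \<noteq> 0"
    using x y by simp_all
  show ?thesis
    unfolding x(1) y(1) mult_fract fract_deriv_Fract[OF x(2)] fract_deriv_Fract[OF y(2)]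
      fract_deriv_Fract[OF bd(1)] poly_deriv_mult add_fract[OF bd(2) bd(3)] eq_fract(1)[OF bd(4) bd(5)]
    by (rule quotient_rule_mult)
qed

lemma fract_deriv_0 [simp]: "fract_deriv i 0 = 0"
  using fract_deriv_add[of i 0 0] by (metis add_0_left add_cancel_left_left)

lemma fract_deriv_1 [simp]: "fract_deriv i 1 = 0"
  using fract_deriv_mult[of i 1 1] by (metis mult_1_left mult_1_right add_cancel_left_left)

lemma fract_deriv_sum: "fract_deriv i (sum f A) = (\<Sum>x\<in>A. fract_deriv i (f x))"
  by (induction A rule: infinite_finite_induct) (simp_all add: fract_deriv_add)

lemma fract_deriv_uminus: "fract_deriv i (- x) = - fract_deriv i x"
  using fract_deriv_add[of i x "- x"] by (simp add: eq_neg_iff_add_eq_0 add.commute)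

lemma fract_deriv_of_nat [simp]: "fract_deriv i (of_nat n) = 0"
  by (induction n) (simp_all add: fract_deriv_add)

lemma fract_deriv_of_int [simp]: "fract_deriv i (of_int n) = 0"
  by (cases n rule: int_cases2) (simp_all add: fract_deriv_uminus)

lemma fract_deriv_scalar [simp]: "fract_deriv i (scalar c) = 0"
proof -
  have "poly_deriv i 1 = (0 :: ('a \<Rightarrow>\<^sub>0 nat) \<Rightarrow>\<^sub>0 complex)"
    by (simp add: poly_deriv_single flip: single_one)
  then show ?thesis
    by (simp add: scalar_def fract_deriv_Fract poly_deriv_single Zero_fract_def)
qed

lemma fract_deriv_omega: "fract_deriv i (omega j) = (if i = j then 1 else 0)"
proof -
  have "poly_deriv i 1 = (0 :: ('a \<Rightarrow>\<^sub>0 nat) \<Rightarrow>\<^sub>0 complex)"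
    by (simp add: poly_deriv_single flip: single_one)
  moreover have "poly_deriv i (Poly_Mapping.single (Poly_Mapping.single j 1) 1)
      = (if i = j then 1 else (0 :: ('a \<Rightarrow>\<^sub>0 nat) \<Rightarrow>\<^sub>0 complex))"
    by (simp add: poly_deriv_single lookup_single)
  ultimately show ?thesis
    by (simp add: omega_def fract_deriv_Fract One_fract_def Zero_fract_def)
qed

section \<open>Stability of the small denominator ring under differentiation\<close>

lemma SD_of_nat: "of_nat n \<in> SD \<alpha>"
  by (induction n) (auto intro: SD.add SD_0 SD_1)

lemma SD_of_int: "of_int n \<in> SD \<alpha>"
  by (cases n rule: int_cases2) (auto intro: SD_uminus SD_of_nat)

lemma SD_diff: "x \<in> SD \<alpha> \<Longrightarrow> y \<in> SD \<alpha> \<Longrightarrow> x - y \<in> SD \<alpha>"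
  using SD.add[OF _ SD_uminus] by force

text \<open>A denominator s = (\<alpha> + \<omega>, J) is affine in \<omega>, so its derivative is
  the integer J_i. Differentiating s (1/s) = 1 then gives - J_i / s^2, again in the ring.\<close>

lemma fract_deriv_SD:
  assumes "x \<in> SD \<alpha>"
  shows "fract_deriv i x \<in> SD \<alpha>"
  using assms
proof induction
  case (small_denominator J)
  let ?s = "\<Sum>l\<in>UNIV. (scalar (\<alpha> l) + omega l) * of_int (J l)"
  have nz: "?s \<noteq> 0" by (rule small_denominator_nonzero) fact
  have "fract_deriv i ?s = (\<Sum>l\<in>UNIV. if i = l then of_int (J l) else 0)"
    unfolding fract_deriv_sum
    by (rule sum.cong) (simp_all add: fract_deriv_mult fract_deriv_add fract_deriv_omega)
  then have s: "fract_deriv i ?s = of_int (J i)" by simp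
  have "fract_deriv i ?s * (1 / ?s) + ?s * fract_deriv i (1 / ?s) = 0"
    using nz fract_deriv_mult[of i ?s "1 / ?s"] by simp
  then have "?s * fract_deriv i (1 / ?s) = - of_int (J i) * (1 / ?s)"
    by (simp add: s add_eq_0_iff)
  then have "fract_deriv i (1 / ?s) = - of_int (J i) * (1 / ?s) * (1 / ?s)"
    using nz by (simp add: field_simps)
  moreover have "1 / ?s \<in> SD \<alpha>" using small_denominator by (rule SD.small_denominator)
  ultimately show ?case
    by (simp only:) (intro SD.mult SD_uminus SD_of_int)
next
  case (add x y)
  then show ?case unfolding fract_deriv_add by (intro SD.add)
next
  case (mult x y)
  then show ?case unfolding fract_deriv_mult by (intro SD.add SD.mult)
qed (simp_all add: fract_deriv_omega SD_0 SD_1)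

section \<open>Power series and their weight filtration\<close>

definition mps_monom :: "('v \<Rightarrow>\<^sub>0 nat) \<Rightarrow> 'a::zero \<Rightarrow> ('v, 'a) mps" where
  "mps_monom x c = Abs_mps (\<lambda>k. if k = x then c else 0)"

lemma mps_coeff_monom: "mps_coeff (mps_monom x c) k = (if k = x then c else 0)"
  by (simp add: mps_monom_def Abs_mps_inverse)

lift_definition mps_map :: "('a \<Rightarrow> 'b) \<Rightarrow> ('v, 'a) mps \<Rightarrow> ('v, 'b) mps"
  is "\<lambda>h f k. h (f k)" .

lemma mps_coeff_times: "mps_coeff (f * g) k = (\<Sum>x | fst x + snd x = k. mps_coeff f (fst x) * mps_coeff g (snd x))"
  by (simp add: times_mps.rep_eq case_prod_unfold)

lemma mps_coeff_sum: "mps_coeff (sum f A) k = (\<Sum>x\<in>A. mps_coeff (f x) k)"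
  by (induction A rule: infinite_finite_induct) (simp_all add: zero_mps.rep_eq plus_mps.rep_eq)

lemmas mps_coeff_simps = plus_mps.rep_eq minus_mps.rep_eq uminus_mps.rep_eq zero_mps.rep_eq
  mps_coeff_sum mps_map.rep_eq

lemma mps_coeff_monom_mult_add: "mps_coeff (mps_monom x c * f) (x + k) = c * mps_coeff f k"
proof -
  have "mps_coeff (mps_monom x c * f) (x + k) = (\<Sum>y\<in>{(x, k)}. mps_coeff (mps_monom x c) (fst y) * mps_coeff f (snd y))"
    unfolding mps_coeff_times
    by (rule sum.mono_neutral_right) (auto simp: mps_coeff_monom)
  then show ?thesis by (simp add: mps_coeff_monom)
qed

lemma mps_coeff_monom_mult_not_add:
  assumes "\<And>k. m \<noteq> x + k"
  shows "mps_coeff (mps_monom x c * f) m = 0"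
  unfolding mps_coeff_times
  by (rule sum.neutral) (use assms in \<open>auto simp: mps_coeff_monom\<close>)

lemma mps_const_eq_monom: "mps_const c = mps_monom 0 c"
  by (rule mps_eqI) (simp add: mps_const.rep_eq mps_coeff_monom)

lemma mps_var_eq_monom: "mps_var v = mps_monom (Poly_Mapping.single v 1) 1"
  by (rule mps_eqI) (simp add: mps_var.rep_eq mps_coeff_monom)

lemma mps_one_eq_monom: "1 = mps_monom 0 1"
  by (rule mps_eqI) (simp add: one_mps.rep_eq mps_coeff_monom)

lemma mps_coeff_const_mult: "mps_coeff (mps_const c * f) k = c * mps_coeff f k"
  using mps_coeff_monom_mult_add[of 0 c f k] by (simp add: mps_const_eq_monom)

lemma mps_monom_mult: "mps_monom x c * mps_monom y d = mps_monom (x + y) (c * d)"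
proof (rule mps_eqI)
  fix m
  show "mps_coeff (mps_monom x c * mps_monom y d) m = mps_coeff (mps_monom (x + y) (c * d)) m"
  proof (cases "\<exists>k. m = x + k")
    case True
    then obtain k where "m = x + k" by blast
    then show ?thesis by (simp only: mps_coeff_monom_mult_add) (simp add: mps_coeff_monom)
  next
    case False
    then show ?thesis by (subst mps_coeff_monom_mult_not_add) (auto simp: mps_coeff_monom)
  qed
qed

lemma mps_const_add: "mps_const (c + d) = mps_const c + mps_const d"
  by (rule mps_eqI) (simp add: mps_const.rep_eq mps_coeff_simps)

lemma mps_const_0 [simp]: "mps_const 0 = 0"
  by (rule mps_eqI) (simp add: mps_const.rep_eq mps_coeff_simps)

lemma mps_const_1 [simp]: "mps_const 1 = 1"
  by (simp add: mps_const_eq_monom mps_one_eq_monom)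

lemma mps_const_mult: "mps_const c * mps_const d = mps_const (c * d)"
  by (simp add: mps_const_eq_monom mps_monom_mult)

lemma of_nat_eq_mps_const: "of_nat n = mps_const (of_nat n)"
  by (induction n) (simp_all add: mps_const_add)

subsection \<open>Formal derivatives\<close>

lemma mps_deriv_add: "mps_deriv v (f + g) = mps_deriv v f + mps_deriv v g"
  by (rule mps_eqI) (simp add: mps_deriv.rep_eq mps_coeff_simps algebra_simps)

lemma mps_deriv_0 [simp]: "mps_deriv v 0 = 0"
  by (rule mps_eqI) (simp add: mps_deriv.rep_eq mps_coeff_simps)

lemma mps_deriv_diff: "mps_deriv v (f - g) = mps_deriv v f - mps_deriv v (g :: ('v, 'a::comm_ring_1) mps)"
  by (rule mps_eqI) (simp add: mps_deriv.rep_eq mps_coeff_simps algebra_simps)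

lemma mps_deriv_sum: "mps_deriv v (sum f A) = (\<Sum>x\<in>A. mps_deriv v (f x))"
  by (induction A rule: infinite_finite_induct) (simp_all add: mps_deriv_add)

lemma mps_deriv_commute: "mps_deriv v (mps_deriv w f) = mps_deriv w (mps_deriv v (f :: ('v, 'a::comm_semiring_1) mps))"
proof (rule mps_eqI)
  fix k
  show "mps_coeff (mps_deriv v (mps_deriv w f)) k = mps_coeff (mps_deriv w (mps_deriv v f)) k"
    by (cases "v = w") (simp_all add: mps_deriv.rep_eq lookup_add lookup_single ac_simps)
qed

text \<open>Pairs whose first exponent lacks \<open>v\<close> contribute nothing; on the others,
  lowering that exponent by one is a bijection onto the pairs with sum \<open>k\<close>.\<close>

lemma mps_coeff_deriv_mult_left:
  fixes f g :: "('v, 'a::comm_ring_1) mps"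
  shows "(\<Sum>x | fst x + snd x = k + Poly_Mapping.single v 1.
      of_nat (Poly_Mapping.lookup (fst x) v) * (mps_coeff f (fst x) * mps_coeff g (snd x)))
    = mps_coeff (mps_deriv v f * g) k" (is "sum ?h ?S = _")
proof -
  let ?e = "Poly_Mapping.single v (1::nat)"
  have "sum ?h ?S = sum ?h {x \<in> ?S. Poly_Mapping.lookup (fst x) v \<noteq> 0}"
    by (rule sum.mono_neutral_right) auto
  also have "\<dots> = (\<Sum>x | fst x + snd x = k. ?h (fst x + ?e, snd x))"
  proof (rule sum.reindex_bij_witness[of _ "\<lambda>x. (fst x + ?e, snd x)" "\<lambda>x. (fst x - ?e, snd x)"])
    fix x assume "x \<in> {x \<in> ?S. Poly_Mapping.lookup (fst x) v \<noteq> 0}"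
    then have x: "fst x + snd x = k + ?e" and "Poly_Mapping.lookup (fst x) v \<noteq> 0" by auto
    then have e: "fst x - ?e + ?e = fst x" using add_single_eq_iff[of "fst x - ?e" v "fst x"] by simp
    then show "(fst (fst x - ?e, snd x) + ?e, snd (fst x - ?e, snd x)) = x"
      and "?h (fst (fst x - ?e, snd x) + ?e, snd (fst x - ?e, snd x)) = ?h x" by simp_all
    have "fst x - ?e + snd x + ?e = (fst x - ?e + ?e) + snd x" by (simp only: ac_simps)
    then have "fst x - ?e + snd x + ?e = k + ?e" by (simp only: e x)
    then show "(fst x - ?e, snd x) \<in> {x. fst x + snd x = k}" by simp
  next
    fix x assume "x \<in> {x. fst x + snd x = k}"
    then have "fst x + snd x = k" by simp
    moreover have "fst x + ?e + snd x = fst x + snd x + ?e" by (simp only: ac_simps)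
    ultimately have "fst x + ?e + snd x = k + ?e" by simp
    then show "(fst x + ?e, snd x) \<in> {x \<in> ?S. Poly_Mapping.lookup (fst x) v \<noteq> 0}"
      by (simp add: lookup_add)
  qed simp
  also have "\<dots> = mps_coeff (mps_deriv v f * g) k"
    unfolding mps_coeff_times
    by (rule sum.cong) (simp_all add: mps_deriv.rep_eq lookup_add ac_simps)
  finally show ?thesis .
qed

text \<open>For exponents a, b adding up to k + e_v, the factor k_v + 1 equals a_v + b_v. The two
  summands give the two terms of the Leibniz rule, the second after exchanging the factors.\<close>

lemma mps_deriv_mult:
  fixes f g :: "('v, 'a::comm_ring_1) mps"
  shows "mps_deriv v (f * g) = mps_deriv v f * g + f * mps_deriv v g"
proof (rule mps_eqI)
  fix k :: "'v \<Rightarrow>\<^sub>0 nat"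
  let ?S = "{x. fst x + snd x = k + Poly_Mapping.single v 1}"
  have "mps_coeff (mps_deriv v (f * g)) k
      = (\<Sum>x\<in>?S. of_nat (Poly_Mapping.lookup k v + 1) * (mps_coeff f (fst x) * mps_coeff g (snd x)))"
    by (simp only: mps_deriv.rep_eq mps_coeff_times sum_distrib_left)
  also have "\<dots> = (\<Sum>x\<in>?S. of_nat (Poly_Mapping.lookup (fst x) v) * (mps_coeff f (fst x) * mps_coeff g (snd x)))
      + (\<Sum>x\<in>?S. of_nat (Poly_Mapping.lookup (snd x) v) * (mps_coeff f (fst x) * mps_coeff g (snd x)))"
    unfolding sum.distrib[symmetric]
  proof (rule sum.cong)
    fix x assume "x \<in> ?S"
    then have "Poly_Mapping.lookup (fst x + snd x) v = Poly_Mapping.lookup (k + Poly_Mapping.single v 1) v" by simp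
    then have "Poly_Mapping.lookup k v + 1 = Poly_Mapping.lookup (fst x) v + Poly_Mapping.lookup (snd x) v"
      by (simp add: lookup_add)
    then show "of_nat (Poly_Mapping.lookup k v + 1) * (mps_coeff f (fst x) * mps_coeff g (snd x))
        = of_nat (Poly_Mapping.lookup (fst x) v) * (mps_coeff f (fst x) * mps_coeff g (snd x))
          + of_nat (Poly_Mapping.lookup (snd x) v) * (mps_coeff f (fst x) * mps_coeff g (snd x))"
      by (simp only: of_nat_add distrib_right)
  qed simp
  also have "(\<Sum>x\<in>?S. of_nat (Poly_Mapping.lookup (snd x) v) * (mps_coeff f (fst x) * mps_coeff g (snd x)))
      = (\<Sum>x\<in>?S. of_nat (Poly_Mapping.lookup (fst x) v) * (mps_coeff g (fst x) * mps_coeff f (snd x)))"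
    by (rule sum.reindex_bij_witness[of _ prod.swap prod.swap]) (auto simp: ac_simps)
  finally show "mps_coeff (mps_deriv v (f * g)) k = mps_coeff (mps_deriv v f * g + f * mps_deriv v g) k"
    by (simp only: mps_coeff_deriv_mult_left mps_coeff_simps mult.commute[of f])
qed

lemma mps_deriv_const [simp]: "mps_deriv v (mps_const c :: ('v, 'a::comm_ring_1) mps) = 0"
proof (rule mps_eqI)
  fix k :: "'v \<Rightarrow>\<^sub>0 nat"
  have "k + Poly_Mapping.single v 1 \<noteq> 0"
    using add_single_eq_iff[of k v 0] by simp
  then show "mps_coeff (mps_deriv v (mps_const c :: ('v, 'a) mps)) k = mps_coeff 0 k"
    by (simp add: mps_deriv.rep_eq mps_const.rep_eq zero_mps.rep_eq)
qed

lemma mps_deriv_var: "mps_deriv v (mps_var w :: ('v, 'a::comm_ring_1) mps) = (if v = w then 1 else 0)"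
proof (rule mps_eqI)
  fix k :: "'v \<Rightarrow>\<^sub>0 nat"
  have "k + Poly_Mapping.single v 1 = Poly_Mapping.single w 1 \<longleftrightarrow> v = w \<and> k = 0"
    unfolding add_single_eq_iff by (auto simp: lookup_single when_def)
  then show "mps_coeff (mps_deriv v (mps_var w :: ('v, 'a) mps)) k = mps_coeff (if v = w then 1 else 0) k"
    by (auto simp: mps_deriv.rep_eq mps_var.rep_eq one_mps.rep_eq zero_mps.rep_eq)
qed

text \<open>The Euler operator of a variable is diagonal on monomials; the eigenvalues of the
  bracket with \<open>H0 \<alpha>\<close> come from this.\<close>

lemma mps_coeff_var_mult_deriv:
  fixes f :: "('v, 'a::comm_ring_1) mps"
  shows "mps_coeff (mps_var v * mps_deriv v f) k = of_nat (Poly_Mapping.lookup k v) * mps_coeff f k"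
proof (cases "Poly_Mapping.lookup k v = 0")
  case True
  then have "k \<noteq> Poly_Mapping.single v 1 + l" for l by (auto simp: lookup_add)
  then show ?thesis using True by (simp add: mps_var_eq_monom mps_coeff_monom_mult_not_add)
next
  case False
  then have "k - Poly_Mapping.single v 1 + Poly_Mapping.single v 1 = k"
    using add_single_eq_iff[of "k - Poly_Mapping.single v 1" v k] by simp
  then have "k = Poly_Mapping.single v 1 + (k - Poly_Mapping.single v 1)"
    by (simp only: add.commute)
  then obtain l where "k = Poly_Mapping.single v 1 + l" ..
  then show ?thesis
    by (simp only: mps_var_eq_monom mps_coeff_monom_mult_add)
      (simp add: mps_deriv.rep_eq lookup_add add.commute)
qed

subsection \<open>Weights\<close>

instance var :: (finite) finite
proof
  have "x \<in> range TauVar \<union> range QVar \<union> range PVar" for x :: "'a var"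
    by (cases x) auto
  then have "(UNIV :: 'a var set) \<subseteq> range TauVar \<union> range QVar \<union> range PVar" by blast
  then show "finite (UNIV :: 'a var set)" by (rule finite_subset) simp
qed

lemma weight_eq_sum: "weight (k :: 'd::finite var \<Rightarrow>\<^sub>0 nat) = (\<Sum>v\<in>UNIV. Poly_Mapping.lookup k v * var_weight v)"
  unfolding weight_def by (rule sum.mono_neutral_left) (auto simp: in_keys_iff)

lemma weight_add: "weight (k + l) = weight k + weight (l :: 'd::finite var \<Rightarrow>\<^sub>0 nat)"
  by (simp add: weight_eq_sum lookup_add distrib_right sum.distrib)

lemma weight_single: "weight (Poly_Mapping.single v n) = n * var_weight v"
  by (cases "n = 0") (simp_all add: weight_def)

text \<open>Every variable has weight at least 1. Hence only finitely many monomials lie below a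
  given weight, and truncations by weight are finite sums.\<close>

lemma lookup_le_weight: "Poly_Mapping.lookup k v \<le> weight (k :: 'd::finite var \<Rightarrow>\<^sub>0 nat)"
proof -
  have "Poly_Mapping.lookup k v \<le> Poly_Mapping.lookup k v * var_weight v"
    by (cases v) auto
  also have "\<dots> \<le> weight k"
    unfolding weight_eq_sum by (rule member_le_sum) auto
  finally show ?thesis .
qed

lemma finite_weight_le: "finite {k :: 'd::finite var \<Rightarrow>\<^sub>0 nat. weight k \<le> n}"
proof (rule finite_subset)
  let ?b = "Abs_poly_mapping (\<lambda>_ :: 'd var. n)"
  have "Poly_Mapping.lookup ?b = (\<lambda>_. n)" by (rule Abs_poly_mapping_inverse) simp
  then show "{k :: 'd var \<Rightarrow>\<^sub>0 nat. weight k \<le> n} \<subseteq> {k. \<forall>v. Poly_Mapping.lookup k v \<le> Poly_Mapping.lookup ?b v}"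
    by (auto intro: order_trans[OF lookup_le_weight])
qed (rule finite_poly_mapping_below)

text \<open>Unlike \<open>bigO\<close>, this filtration does not ask for coefficients in
  \<open>SD \<alpha>\<close>, so weight estimates need no membership conditions.\<close>

definition weight_ge :: "nat \<Rightarrow> 'd::{finite,linorder} series set" where
  "weight_ge n = {f. \<forall>k. weight k < n \<longrightarrow> mps_coeff f k = 0}"

lemma weight_geI: "(\<And>k. weight k < n \<Longrightarrow> mps_coeff f k = 0) \<Longrightarrow> f \<in> weight_ge n"
  by (simp add: weight_ge_def)

lemma weight_geD: "f \<in> weight_ge n \<Longrightarrow> weight k < n \<Longrightarrow> mps_coeff f k = 0"
  by (simp add: weight_ge_def)

lemma weight_ge_0 [simp]: "f \<in> weight_ge 0"
  by (simp add: weight_ge_def)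

lemma weight_ge_zero [simp]: "0 \<in> weight_ge n"
  by (simp add: weight_ge_def zero_mps.rep_eq)

lemma weight_ge_mono: "f \<in> weight_ge n \<Longrightarrow> m \<le> n \<Longrightarrow> f \<in> weight_ge m"
  by (simp add: weight_ge_def)

lemma weight_ge_add: "f \<in> weight_ge n \<Longrightarrow> g \<in> weight_ge n \<Longrightarrow> f + g \<in> weight_ge n"
  by (simp add: weight_ge_def plus_mps.rep_eq)

lemma weight_ge_diff: "f \<in> weight_ge n \<Longrightarrow> g \<in> weight_ge n \<Longrightarrow> f - g \<in> weight_ge n"
  by (simp add: weight_ge_def minus_mps.rep_eq)

lemma weight_ge_uminus: "f \<in> weight_ge n \<Longrightarrow> - f \<in> weight_ge n"
  by (simp add: weight_ge_def uminus_mps.rep_eq)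

lemma weight_ge_sum: "(\<And>x. x \<in> A \<Longrightarrow> f x \<in> weight_ge n) \<Longrightarrow> sum f A \<in> weight_ge n"
  by (simp add: weight_ge_def mps_coeff_sum)

lemma weight_ge_mult:
  assumes "f \<in> weight_ge m" "g \<in> weight_ge n"
  shows "f * g \<in> weight_ge (m + n)"
proof (rule weight_geI)
  fix k :: "'a var \<Rightarrow>\<^sub>0 nat" assume k: "weight k < m + n"
  show "mps_coeff (f * g) k = 0"
    unfolding mps_coeff_times
  proof (rule sum.neutral, rule ballI)
    fix x assume "x \<in> {x. fst x + snd x = k}"
    then have "weight (fst x) + weight (snd x) = weight k" by (auto simp: weight_add)
    with k have "weight (fst x) < m \<or> weight (snd x) < n" by linarith
    then show "mps_coeff f (fst x) * mps_coeff g (snd x) = 0"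
      using assms by (auto dest: weight_geD)
  qed
qed

lemma weight_ge_const_mult: "f \<in> weight_ge n \<Longrightarrow> mps_const c * f \<in> weight_ge n"
  by (simp add: weight_ge_def mps_coeff_const_mult)

lemma weight_ge_prod:
  "finite A \<Longrightarrow> (\<And>x. x \<in> A \<Longrightarrow> f x \<in> weight_ge (w x)) \<Longrightarrow> prod f A \<in> weight_ge (sum w A)"
  by (induction A rule: finite_induct) (simp_all add: weight_ge_mult)

lemma weight_ge_power: "f \<in> weight_ge n \<Longrightarrow> f ^ k \<in> weight_ge (k * n)"
  by (induction k) (simp_all add: weight_ge_mult)

lemma weight_ge_monom: "weight x \<ge> n \<Longrightarrow> mps_monom x c \<in> weight_ge n"
  by (rule weight_geI) (auto simp: mps_coeff_monom)

lemma weight_ge_var: "mps_var v \<in> weight_ge (var_weight v)"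
  by (simp add: mps_var_eq_monom weight_ge_monom weight_single)

lemma weight_ge_deriv:
  assumes "f \<in> weight_ge n"
  shows "mps_deriv v f \<in> weight_ge (n - var_weight v)"
  using assms by (auto intro!: weight_geI simp: mps_deriv.rep_eq weight_add weight_single dest!: weight_geD)

text \<open>The filtration is separated, so identities between infinite series may be checked modulo
  each weight.\<close>

lemma weight_ge_eqI:
  assumes "\<And>n. f - g \<in> weight_ge n"
  shows "f = g"
proof (rule mps_eqI)
  fix k
  show "mps_coeff f k = mps_coeff g k"
    using weight_geD[OF assms[of "Suc (weight k)"], of k] by (simp add: minus_mps.rep_eq)
qed

lemma diff_sum_monom_weight_ge:
  "f - (\<Sum>x | weight x \<le> n. mps_monom x (mps_coeff f x)) \<in> weight_ge (Suc n)"
  by (rule weight_geI) (simp add: mps_coeff_simps mps_coeff_monom finite_weight_le)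

section \<open>Derivations of the Poisson algebra\<close>

lemma ring_R_iff: "f \<in> carrier (ring_R \<alpha>) \<longleftrightarrow> (\<forall>k. mps_coeff f k \<in> SD \<alpha>)"
  by (simp add: ring_R_def)

lemma ring_R_add: "f \<in> carrier (ring_R \<alpha>) \<Longrightarrow> g \<in> carrier (ring_R \<alpha>) \<Longrightarrow> f + g \<in> carrier (ring_R \<alpha>)"
  by (simp add: ring_R_iff plus_mps.rep_eq SD.add)

lemma ring_R_diff: "f \<in> carrier (ring_R \<alpha>) \<Longrightarrow> g \<in> carrier (ring_R \<alpha>) \<Longrightarrow> f - g \<in> carrier (ring_R \<alpha>)"
  by (simp add: ring_R_iff minus_mps.rep_eq SD_diff)

lemma ring_R_zero: "0 \<in> carrier (ring_R \<alpha>)"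
  by (simp add: ring_R_iff zero_mps.rep_eq SD_0)

lemma ring_R_one: "1 \<in> carrier (ring_R \<alpha>)"
  by (simp add: ring_R_iff one_mps.rep_eq SD_0 SD_1)

lemma ring_R_uminus: "f \<in> carrier (ring_R \<alpha>) \<Longrightarrow> - f \<in> carrier (ring_R \<alpha>)"
  by (simp add: ring_R_iff uminus_mps.rep_eq SD_uminus)

lemma ring_R_mult: "f \<in> carrier (ring_R \<alpha>) \<Longrightarrow> g \<in> carrier (ring_R \<alpha>) \<Longrightarrow> f * g \<in> carrier (ring_R \<alpha>)"
  by (simp add: ring_R_iff mps_coeff_times SD_sum SD.mult)

lemma ring_R_sum: "(\<And>x. x \<in> A \<Longrightarrow> f x \<in> carrier (ring_R \<alpha>)) \<Longrightarrow> sum f A \<in> carrier (ring_R \<alpha>)"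
  by (simp add: ring_R_iff mps_coeff_sum SD_sum)

lemma ring_R_prod: "(\<And>x. x \<in> A \<Longrightarrow> f x \<in> carrier (ring_R \<alpha>)) \<Longrightarrow> prod f A \<in> carrier (ring_R \<alpha>)"
  by (induction A rule: infinite_finite_induct) (simp_all add: ring_R_one ring_R_mult)

lemma ring_R_power: "f \<in> carrier (ring_R \<alpha>) \<Longrightarrow> f ^ n \<in> carrier (ring_R \<alpha>)"
  by (induction n) (simp_all add: ring_R_one ring_R_mult)

lemma ring_R_monom: "c \<in> SD \<alpha> \<Longrightarrow> mps_monom x c \<in> carrier (ring_R \<alpha>)"
  by (simp add: ring_R_iff mps_coeff_monom SD_0)

lemma ring_R_const: "c \<in> SD \<alpha> \<Longrightarrow> mps_const c \<in> carrier (ring_R \<alpha>)"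
  by (simp add: mps_const_eq_monom ring_R_monom)

lemma ring_R_var: "mps_var v \<in> carrier (ring_R \<alpha>)"
  by (simp add: mps_var_eq_monom ring_R_monom SD_1)

lemma ring_R_deriv: "f \<in> carrier (ring_R \<alpha>) \<Longrightarrow> mps_deriv v f \<in> carrier (ring_R \<alpha>)"
  unfolding ring_R_iff mps_deriv.rep_eq by (intro allI SD.mult SD_of_nat) blast

lemma ring_R_H0: "H0 \<alpha> \<in> carrier (ring_R \<alpha>)"
  unfolding H0_def
  by (intro ring_R_sum ring_R_mult ring_R_const ring_R_var SD.add SD.scalar SD.omega)

subsection \<open>The Poisson bracket\<close>

lemma poisson_bracket_add_left: "poisson_bracket (f + g) h = poisson_bracket f h + poisson_bracket g h"
  by (simp add: poisson_bracket_def mps_deriv_add sum.distrib[symmetric] algebra_simps)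

lemma poisson_bracket_add_right: "poisson_bracket h (f + g) = poisson_bracket h f + poisson_bracket h g"
  by (simp add: poisson_bracket_def mps_deriv_add sum.distrib[symmetric] algebra_simps)

lemma poisson_bracket_zero_right [simp]: "poisson_bracket h 0 = 0"
  by (simp add: poisson_bracket_def)

lemma poisson_bracket_zero_left [simp]: "poisson_bracket 0 h = 0"
  by (simp add: poisson_bracket_def)

lemma poisson_bracket_mult_left: "poisson_bracket (f * g) h = poisson_bracket f h * g + f * poisson_bracket g h"
  by (simp add: poisson_bracket_def mps_deriv_mult sum_distrib_left sum_distrib_right
      sum.distrib[symmetric] algebra_simps)

lemma poisson_bracket_mult_right: "poisson_bracket h (f * g) = poisson_bracket h f * g + f * poisson_bracket h g"
  by (simp add: poisson_bracket_def mps_deriv_mult sum_distrib_left sum_distrib_right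
      sum.distrib[symmetric] algebra_simps)

lemma poisson_bracket_const_left [simp]: "poisson_bracket (mps_const c) h = 0"
  by (simp add: poisson_bracket_def)

lemma mps_deriv_poisson_bracket:
  "mps_deriv v (poisson_bracket f g) = poisson_bracket (mps_deriv v f) g + poisson_bracket f (mps_deriv v g)"
  by (simp add: poisson_bracket_def mps_deriv_sum mps_deriv_diff mps_deriv_mult
      mps_deriv_commute[of v] sum.distrib[symmetric] algebra_simps)

text \<open>The Jacobi identity, written as the Leibniz rule of the bracket with
  \<open>s\<close>.\<close>

lemma jacobi_identity:
  "poisson_bracket (poisson_bracket f g) s
     = poisson_bracket (poisson_bracket f s) g + poisson_bracket f (poisson_bracket g s)"
proof -
  let ?q = "\<lambda>i. mps_deriv (QVar i)" and ?p = "\<lambda>i. mps_deriv (PVar i)"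
  define b where "b f g i = ?q i f * ?p i g - ?p i f * ?q i g" for f g :: "'a series" and i
  have pb: "poisson_bracket f g = (\<Sum>i\<in>UNIV. b f g i)" for f g
    by (simp add: poisson_bracket_def b_def)
  \<comment> \<open>\<open>V\<close> and \<open>W\<close> collect the terms with second derivatives
    of \<open>s\<close>, \<open>U\<close> those with second derivatives of \<open>f\<close> or
    \<open>g\<close>.\<close>
  define V where "V i j = b f (?q i s) j * ?p i g - b f (?p i s) j * ?q i g" for i j
  define W where "W i j = ?q i f * b g (?p i s) j - ?p i f * b g (?q i s) j" for i j
  define U where "U i j = (b (?q i f) s j * ?p i g - b (?p i f) s j * ?q i g)
      + (?q i f * b (?p i g) s j - ?p i f * b (?q i g) s j)" for i j
  have lhs: "poisson_bracket (poisson_bracket f g) s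
      = (\<Sum>j\<in>UNIV. \<Sum>i\<in>UNIV. (b (?q j f) g i + b f (?q j g) i) * ?p j s - (b (?p j f) g i + b f (?p j g) i) * ?q j s)"
    unfolding poisson_bracket_def[of "poisson_bracket f g"] mps_deriv_poisson_bracket
    by (simp only: pb sum.distrib[symmetric] sum_subtractf sum_distrib_right)
  have "(b (?q j f) g i + b f (?q j g) i) * ?p j s - (b (?p j f) g i + b f (?p j g) i) * ?q j s = U i j" for i j
    by (simp add: b_def U_def mps_deriv_commute[of "PVar j"] mps_deriv_commute[of "QVar j" "QVar i"]
        mps_deriv_commute[of "QVar j" "PVar i"] algebra_simps)
  then have lhs: "poisson_bracket (poisson_bracket f g) s = (\<Sum>i\<in>UNIV. \<Sum>j\<in>UNIV. U i j)"
    unfolding lhs by (simp add: sum.swap[of U])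
  \<comment> \<open>Partial derivatives commute, so the second derivatives of \<open>s\<close>
    cancel once the two indices are exchanged in one of the sums.\<close>
  have "V j i + W i j = 0" for i j
    by (simp add: V_def W_def b_def mps_deriv_commute[of "PVar j"] mps_deriv_commute[of "QVar j" "QVar i"]
        mps_deriv_commute[of "QVar j" "PVar i"] algebra_simps)
  then have VW: "(\<Sum>i\<in>UNIV. \<Sum>j\<in>UNIV. V i j) + (\<Sum>i\<in>UNIV. \<Sum>j\<in>UNIV. W i j) = 0"
    by (subst sum.swap) (simp add: sum.distrib[symmetric])
  have "poisson_bracket (poisson_bracket f s) g + poisson_bracket f (poisson_bracket g s)
      = (\<Sum>i\<in>UNIV. \<Sum>j\<in>UNIV. U i j) + ((\<Sum>i\<in>UNIV. \<Sum>j\<in>UNIV. V i j) + (\<Sum>i\<in>UNIV. \<Sum>j\<in>UNIV. W i j))"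
    unfolding poisson_bracket_def[of "poisson_bracket f s"] poisson_bracket_def[of f "poisson_bracket g s"]
      mps_deriv_poisson_bracket
    by (simp add: pb U_def V_def W_def sum.distrib sum_subtractf sum_distrib_right sum_distrib_left algebra_simps)
  then show ?thesis by (simp add: lhs VW)
qed

text \<open>Each term of the bracket differentiates once by a q and once by a p, both of weight
  1.\<close>

lemma weight_ge_poisson_bracket:
  assumes "f \<in> weight_ge m" "g \<in> weight_ge n"
  shows "poisson_bracket f g \<in> weight_ge (m + n - 2)"
proof -
  have d: "mps_deriv (QVar i) f \<in> weight_ge (m - 1)" "mps_deriv (PVar i) f \<in> weight_ge (m - 1)"
    "mps_deriv (QVar i) g \<in> weight_ge (n - 1)" "mps_deriv (PVar i) g \<in> weight_ge (n - 1)" for i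
    using weight_ge_deriv[OF assms(1)] weight_ge_deriv[OF assms(2)] by (metis var_weight.simps)+
  show ?thesis
    unfolding poisson_bracket_def
    by (intro weight_ge_sum weight_ge_diff weight_ge_mono[OF weight_ge_mult[OF d(1) d(4)]]
        weight_ge_mono[OF weight_ge_mult[OF d(2) d(3)]]) auto
qed

lemma ring_R_poisson_bracket:
  "f \<in> carrier (ring_R \<alpha>) \<Longrightarrow> g \<in> carrier (ring_R \<alpha>) \<Longrightarrow> poisson_bracket f g \<in> carrier (ring_R \<alpha>)"
  unfolding poisson_bracket_def by (intro ring_R_sum ring_R_diff ring_R_mult ring_R_deriv)

subsection \<open>Differentiating the coefficients\<close>

definition omega_deriv :: "'d \<Rightarrow> 'd::{finite,linorder} series \<Rightarrow> 'd series" where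
  "omega_deriv i = mps_map (fract_deriv i)"

lemma mps_coeff_omega_deriv: "mps_coeff (omega_deriv i f) k = fract_deriv i (mps_coeff f k)"
  by (simp add: omega_deriv_def mps_map.rep_eq)

lemma omega_deriv_add: "omega_deriv i (f + g) = omega_deriv i f + omega_deriv i g"
  by (rule mps_eqI) (simp add: mps_coeff_omega_deriv plus_mps.rep_eq fract_deriv_add)

lemma omega_deriv_0 [simp]: "omega_deriv i 0 = 0"
  by (rule mps_eqI) (simp add: mps_coeff_omega_deriv zero_mps.rep_eq)

lemma omega_deriv_uminus: "omega_deriv i (- f) = - omega_deriv i f"
  by (rule mps_eqI) (simp add: mps_coeff_omega_deriv uminus_mps.rep_eq fract_deriv_uminus)

lemma omega_deriv_diff: "omega_deriv i (f - g) = omega_deriv i f - omega_deriv i g"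
  using omega_deriv_add[of i f "- g"] by (simp add: omega_deriv_uminus)

lemma omega_deriv_sum: "omega_deriv i (sum f A) = (\<Sum>x\<in>A. omega_deriv i (f x))"
  by (induction A rule: infinite_finite_induct) (simp_all add: omega_deriv_add)

lemma omega_deriv_mult: "omega_deriv i (f * g) = omega_deriv i f * g + f * omega_deriv i g"
  by (rule mps_eqI) (simp add: mps_coeff_omega_deriv plus_mps.rep_eq mps_coeff_times fract_deriv_sum
      fract_deriv_mult sum.distrib)

lemma omega_deriv_const: "omega_deriv i (mps_const c) = mps_const (fract_deriv i c)"
  by (rule mps_eqI) (simp add: mps_coeff_omega_deriv mps_const.rep_eq)

lemma omega_deriv_var [simp]: "omega_deriv i (mps_var v) = 0"
  by (rule mps_eqI) (simp add: mps_coeff_omega_deriv mps_var.rep_eq zero_mps.rep_eq)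

lemma omega_deriv_mps_deriv: "omega_deriv i (mps_deriv v f) = mps_deriv v (omega_deriv i f)"
  by (rule mps_eqI) (simp add: mps_coeff_omega_deriv mps_deriv.rep_eq fract_deriv_mult fract_deriv_add)

lemma omega_deriv_poisson_bracket:
  "omega_deriv i (poisson_bracket f g) = poisson_bracket (omega_deriv i f) g + poisson_bracket f (omega_deriv i g)"
  by (simp add: poisson_bracket_def omega_deriv_sum omega_deriv_diff omega_deriv_mult
      omega_deriv_mps_deriv sum.distrib[symmetric] algebra_simps)

lemma weight_ge_omega_deriv: "f \<in> weight_ge n \<Longrightarrow> omega_deriv i f \<in> weight_ge n"
  by (simp add: weight_ge_def mps_coeff_omega_deriv)

lemma ring_R_omega_deriv: "f \<in> carrier (ring_R \<alpha>) \<Longrightarrow> omega_deriv i f \<in> carrier (ring_R \<alpha>)"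
  by (simp add: ring_R_iff mps_coeff_omega_deriv fract_deriv_SD)

lemma omega_deriv_H0: "omega_deriv i (H0 \<alpha>) = mps_var (PVar i) * mps_var (QVar i)"
proof -
  have "omega_deriv i (H0 \<alpha>) = (\<Sum>j\<in>UNIV. mps_const (if i = j then 1 else 0) * mps_var (PVar j) * mps_var (QVar j))"
    unfolding H0_def omega_deriv_sum
    by (rule sum.cong) (simp_all add: omega_deriv_mult omega_deriv_const fract_deriv_add fract_deriv_omega)
  also have "\<dots> = (\<Sum>j\<in>UNIV. if i = j then mps_var (PVar j) * mps_var (QVar j) else 0)"
    by (rule sum.cong) simp_all
  finally show ?thesis by simp
qed

lemma ring_R0_imp_ring_R: "f \<in> ring_R0 \<alpha> \<Longrightarrow> f \<in> carrier (ring_R \<alpha>)"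
  by (simp add: ring_R0_def)

lemma ring_R0_deriv:
  assumes "f \<in> ring_R0 \<alpha>" "v \<notin> range TauVar"
  shows "mps_deriv v f = 0"
proof (rule mps_eqI)
  fix k :: "'a var \<Rightarrow>\<^sub>0 nat"
  have "v \<in> Poly_Mapping.keys (k + Poly_Mapping.single v 1)"
    unfolding in_keys_iff lookup_add lookup_single by simp
  then have "mps_coeff f (k + Poly_Mapping.single v 1) = 0"
    using assms by (auto simp: ring_R0_def)
  then show "mps_coeff (mps_deriv v f) k = mps_coeff 0 k"
    by (simp only: mps_deriv.rep_eq zero_mps.rep_eq mult_zero_right)
qed

text \<open>Elements of R_0 have vanishing q- and p-derivatives, so they behave as constants in both
  arguments of the bracket.\<close>

lemma ring_R0_poisson_bracket_mult:
  assumes "a \<in> ring_R0 \<alpha>"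
  shows "poisson_bracket (a * f) g = a * poisson_bracket f g"
    and "poisson_bracket f (a * g) = a * poisson_bracket f g"
proof -
  have "mps_deriv (QVar i) a = 0" "mps_deriv (PVar i) a = 0" for i
    using assms by (auto intro!: ring_R0_deriv)
  then have "poisson_bracket a h = 0" "poisson_bracket h a = 0" for h
    by (simp_all add: poisson_bracket_def)
  then show "poisson_bracket (a * f) g = a * poisson_bracket f g"
    and "poisson_bracket f (a * g) = a * poisson_bracket f g"
    by (simp_all add: poisson_bracket_mult_left poisson_bracket_mult_right)
qed

section \<open>Derivations of both the product and the bracket\<close>

text \<open>The sum of a Hamiltonian vector field and a vector field in the frequencies; the second
  part moves \<omega>, which every Hamiltonian field fixes.\<close>

definition poisson_derivation ::
    "'d::{finite,linorder} series \<Rightarrow> ('d \<Rightarrow> 'd series) \<Rightarrow> 'd series \<Rightarrow> 'd series" where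
  "poisson_derivation s a f = poisson_bracket f s + (\<Sum>i\<in>UNIV. a i * omega_deriv i f)"

lemma poisson_derivation_add: "poisson_derivation s a (f + g) = poisson_derivation s a f + poisson_derivation s a g"
  by (simp add: poisson_derivation_def poisson_bracket_add_left omega_deriv_add distrib_left sum.distrib)

lemma poisson_derivation_mult:
  "poisson_derivation s a (f * g) = poisson_derivation s a f * g + f * poisson_derivation s a g"
  by (simp add: poisson_derivation_def poisson_bracket_mult_left omega_deriv_mult distrib_left
      distrib_right sum.distrib sum_distrib_left sum_distrib_right ac_simps)

lemma poisson_derivation_scalar: "poisson_derivation s a (mps_const (scalar c)) = 0"
  by (simp add: poisson_derivation_def omega_deriv_const)

lemma poisson_bracket_sum_left: "poisson_bracket (sum f A) g = (\<Sum>x\<in>A. poisson_bracket (f x) g)"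
  by (induction A rule: infinite_finite_induct) (simp_all add: poisson_bracket_add_left)

lemma poisson_bracket_sum_right: "poisson_bracket g (sum f A) = (\<Sum>x\<in>A. poisson_bracket g (f x))"
  by (induction A rule: infinite_finite_induct) (simp_all add: poisson_bracket_add_right)

text \<open>For the Hamiltonian part this is the Jacobi identity. For the other part the
  \<open>a i\<close> must be central, so that they can be pulled out of the brackets.\<close>

lemma poisson_derivation_bracket:
  assumes "\<And>i. a i \<in> ring_R0 \<alpha>"
  shows "poisson_derivation s a (poisson_bracket f g)
    = poisson_bracket (poisson_derivation s a f) g + poisson_bracket f (poisson_derivation s a g)"
  unfolding poisson_derivation_def poisson_bracket_add_left poisson_bracket_add_right
    poisson_bracket_sum_left poisson_bracket_sum_right ring_R0_poisson_bracket_mult[OF assms]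
    omega_deriv_poisson_bracket jacobi_identity[of f g s]
  by (simp add: distrib_left sum.distrib ac_simps)

text \<open>The bracket lowers the weight by 2, hence \<open>s\<close> starts two weights above the
  coefficients \<open>a i\<close>.\<close>

lemma weight_ge_poisson_derivation:
  assumes "s \<in> weight_ge (n + 2)" "\<And>i. a i \<in> weight_ge n" "f \<in> weight_ge m"
  shows "poisson_derivation s a f \<in> weight_ge (m + n)"
proof -
  have "poisson_bracket f s \<in> weight_ge (m + n)"
    using weight_ge_poisson_bracket[OF assms(3,1)] by simp
  moreover have "a i * omega_deriv i f \<in> weight_ge (m + n)" for i
    using weight_ge_mult[OF assms(2)[of i] weight_ge_omega_deriv[OF assms(3), of i]]
    by (simp only: add.commute)
  ultimately show ?thesis
    unfolding poisson_derivation_def by (intro weight_ge_add weight_ge_sum)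
qed

lemma ring_R_poisson_derivation:
  assumes "s \<in> carrier (ring_R \<alpha>)" "\<And>i. a i \<in> carrier (ring_R \<alpha>)" "f \<in> carrier (ring_R \<alpha>)"
  shows "poisson_derivation s a f \<in> carrier (ring_R \<alpha>)"
  unfolding poisson_derivation_def using assms
  by (intro ring_R_add ring_R_poisson_bracket ring_R_sum ring_R_mult ring_R_omega_deriv)

section \<open>Diagonalisation of the bracket with the quadratic Hamiltonian\<close>

definition frequency :: "('d::{finite,linorder} \<Rightarrow> complex) \<Rightarrow> ('d var \<Rightarrow>\<^sub>0 nat) \<Rightarrow> 'd ratfun" where
  "frequency \<alpha> k = (\<Sum>i\<in>UNIV. (scalar (\<alpha> i) + omega i)
     * of_int (int (Poly_Mapping.lookup k (PVar i)) - int (Poly_Mapping.lookup k (QVar i))))"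

text \<open>The bracket with \<open>H0 \<alpha>\<close> is the combination of the Euler operators of
  p_i minus those of q_i with coefficients \<alpha>_i + \<omega>_i.\<close>

lemma mps_coeff_poisson_bracket_H0:
  "mps_coeff (poisson_bracket (H0 \<alpha>) s) k = frequency \<alpha> k * mps_coeff s k"
proof -
  let ?c = "\<lambda>i. mps_const (scalar (\<alpha> i) + omega i) :: 'a series"
  have q: "mps_deriv (QVar i) (H0 \<alpha>) = ?c i * mps_var (PVar i)" for i
  proof -
    have "mps_deriv (QVar i) (H0 \<alpha>) = (\<Sum>j\<in>UNIV. if i = j then ?c j * mps_var (PVar j) else 0)"
      unfolding H0_def mps_deriv_sum by (rule sum.cong) (simp_all add: mps_deriv_mult mps_deriv_var)
    then show ?thesis by simp
  qed
  have p: "mps_deriv (PVar i) (H0 \<alpha>) = ?c i * mps_var (QVar i)" for i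
  proof -
    have "mps_deriv (PVar i) (H0 \<alpha>) = (\<Sum>j\<in>UNIV. if i = j then ?c j * mps_var (QVar j) else 0)"
      unfolding H0_def mps_deriv_sum by (rule sum.cong) (simp_all add: mps_deriv_mult mps_deriv_var)
    then show ?thesis by simp
  qed
  show ?thesis
    unfolding poisson_bracket_def q p mult.assoc mps_coeff_sum frequency_def sum_distrib_right
      minus_mps.rep_eq mps_coeff_const_mult mps_coeff_var_mult_deriv
    by (rule sum.cong) (simp_all add: algebra_simps)
qed

section \<open>The path-ordered exponential\<close>

subsection \<open>Series converging in the weight filtration\<close>

text \<open>If \<open>u n\<close> has weight at least \<open>n\<close>, the terms beyond
  \<open>weight k\<close> do not reach the monomial \<open>k\<close>. The cutoff thus gives the
  infinite sum while keeping the definition total.\<close>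

definition weight_series :: "(nat \<Rightarrow> 'd::{finite,linorder} series) \<Rightarrow> 'd series" where
  "weight_series u = Abs_mps (\<lambda>k. \<Sum>n\<le>weight k. mps_coeff (u n) k)"

lemma mps_coeff_weight_series: "mps_coeff (weight_series u) k = (\<Sum>n\<le>weight k. mps_coeff (u n) k)"
  by (simp add: weight_series_def Abs_mps_inverse)

lemma weight_series_approx:
  assumes "\<And>n. u n \<in> weight_ge n"
  shows "weight_series u - (\<Sum>n\<le>N. u n) \<in> weight_ge (Suc N)"
proof (rule weight_geI)
  fix k :: "'a var \<Rightarrow>\<^sub>0 nat" assume "weight k < Suc N"
  then have "(\<Sum>n\<le>weight k. mps_coeff (u n) k) = (\<Sum>n\<le>N. mps_coeff (u n) k)"
    using weight_geD[OF assms] by (intro sum.mono_neutral_left) auto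
  then show "mps_coeff (weight_series u - (\<Sum>n\<le>N. u n)) k = 0"
    by (simp add: mps_coeff_simps mps_coeff_weight_series)
qed

lemma ring_R_weight_series: "(\<And>n. u n \<in> carrier (ring_R \<alpha>)) \<Longrightarrow> weight_series u \<in> carrier (ring_R \<alpha>)"
  by (simp add: ring_R_iff mps_coeff_weight_series SD_sum)

lemma weight_ge_limit: "f - g \<in> weight_ge n \<Longrightarrow> g - h \<in> weight_ge n \<Longrightarrow> f - h \<in> weight_ge n"
  using weight_ge_add[of "f - g" n "g - h"] by simp

text \<open>The inverse of the identity plus \<open>N\<close> is the Neumann series.\<close>

lemma bij_betw_id_plus_weight_raising:
  fixes N :: "'d::{finite,linorder} series \<Rightarrow> 'd series"
  assumes add: "\<And>f g. N (f + g) = N f + N g"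
    and raise: "\<And>f m. f \<in> weight_ge m \<Longrightarrow> N f \<in> weight_ge (Suc m)"
    and R: "\<And>f. f \<in> carrier (ring_R \<alpha>) \<Longrightarrow> N f \<in> carrier (ring_R \<alpha>)"
  shows "bij_betw (\<lambda>f. f + N f) (carrier (ring_R \<alpha>)) (carrier (ring_R \<alpha>))"
proof -
  have N0: "N 0 = 0" using add[of 0 0] by simp
  have diff: "N (f - g) = N f - N g" for f g
    using add[of "f - g" g] by simp
  have sum: "N (sum u A) = (\<Sum>x\<in>A. N (u x))" for u :: "nat \<Rightarrow> _" and A
    by (induction A rule: infinite_finite_induct) (simp_all add: N0 add)
  have "f = g" if "f + N f = g + N g" for f g
  proof (rule weight_ge_eqI)
    fix n
    \<comment> \<open>Each use of this equation raises the weight of the difference by one.\<close>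
    have "f - g = - N (f - g)" using that by (simp add: diff algebra_simps)
    then show "f - g \<in> weight_ge n"
      by (induction n) (use raise weight_ge_uminus in force)+
  qed
  then have "inj_on (\<lambda>f. f + N f) (carrier (ring_R \<alpha>))" by (auto intro: inj_onI)
  moreover have "\<exists>h \<in> carrier (ring_R \<alpha>). g = h + N h" if g: "g \<in> carrier (ring_R \<alpha>)" for g
  proof -
    define u where "u n = ((\<lambda>f. - N f) ^^ n) g" for n
    have u_Suc: "N (u n) = - u (Suc n)" for n by (simp add: u_def)
    have uw: "u n \<in> weight_ge n" for n
      by (induction n) (simp_all add: u_def raise weight_ge_uminus)
    have uR: "u n \<in> carrier (ring_R \<alpha>)" for n
      by (induction n) (simp_all add: u_def g R ring_R_uminus)
    define h where "h = weight_series u"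
    have "g - (h + N h) \<in> weight_ge m" for m
    proof -
      let ?e = "h - (\<Sum>n\<le>m. u n)"
      have e: "?e \<in> weight_ge (Suc m)" unfolding h_def by (rule weight_series_approx) (rule uw)
      \<comment> \<open>As \<open>N\<close> sends \<open>u n\<close> to \<open>- u (Suc n)\<close>,
        the partial sums telescope to \<open>g\<close>, up to a term of high weight.\<close>
      have "(\<Sum>n\<le>m. u n) - (\<Sum>n\<le>m. u (Suc n)) = u 0 - u (Suc m)"
        unfolding sum_subtractf[symmetric] by (rule sum_telescope)
      moreover have "N h = N ?e - (\<Sum>n\<le>m. u (Suc n))"
        by (simp add: diff sum u_Suc sum_negf)
      moreover have "u 0 = g" by (simp add: u_def)
      ultimately have "g - (h + N h) = u (Suc m) - ?e - N ?e" by (simp add: algebra_simps)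
      moreover have "u (Suc m) - ?e - N ?e \<in> weight_ge (Suc m)"
        by (rule weight_ge_diff[OF weight_ge_diff[OF uw e] weight_ge_mono[OF raise[OF e]]]) simp
      ultimately have "g - (h + N h) \<in> weight_ge (Suc m)" by (simp only:)
      then show ?thesis by (rule weight_ge_mono) simp
    qed
    then have "g = h + N h" by (rule weight_ge_eqI)
    moreover have "h \<in> carrier (ring_R \<alpha>)" unfolding h_def by (rule ring_R_weight_series) (rule uR)
    ultimately show ?thesis by blast
  qed
  ultimately show ?thesis
    unfolding bij_betw_def by (auto intro: ring_R_add R)
qed

lemma scalar_mult: "scalar c * scalar d = scalar (c * d)"
  by (simp add: scalar_def mult_single)

lemma scalar_add: "scalar (c + d) = scalar c + scalar d"
  by (simp add: scalar_def single_add)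

lemma scalar_of_nat: "scalar (of_nat n) = of_nat n"
  by (induction n) (simp_all add: scalar_0 scalar_1 scalar_add)

text \<open>The inverse of \<open>n\<close> is taken among the complex scalars, so multiplying by it
  preserves R and the weights.\<close>

abbreviation nat_inverse :: "nat \<Rightarrow> 'd::{finite,linorder} series" where
  "nat_inverse n \<equiv> mps_const (scalar (1 / of_nat n))"

lemma of_nat_mult_nat_inverse: "n > 0 \<Longrightarrow> of_nat n * nat_inverse n = 1"
proof -
  assume "n > 0"
  have "of_nat n * nat_inverse n = (mps_const (scalar (of_nat n) * scalar (1 / of_nat n)) :: 'a series)"
    by (simp add: of_nat_eq_mps_const mps_const_mult scalar_of_nat)
  with \<open>n > 0\<close> show ?thesis by (simp add: scalar_mult scalar_1)
qed

lemma of_nat_mult_cancel: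
  fixes f g :: "'d::{finite,linorder} series"
  assumes "n > 0" "of_nat n * f = of_nat n * g"
  shows "f = g"
proof -
  have "of_nat n * nat_inverse n * f = of_nat n * nat_inverse n * g"
    by (simp only: assms(2) mult.assoc mult.left_commute[of "of_nat n"])
  then show ?thesis by (simp add: of_nat_mult_nat_inverse assms(1))
qed

subsection \<open>Homogeneous components\<close>

text \<open>The component of degree \<open>n\<close> in \<open>t\<close> of the solution of \<open>t d/dt \<Phi> = \<Phi> \<circ> \<Sum> t^k D k\<close>, \<open>\<Phi> = id\<close>
  at \<open>t = 0\<close>.\<close>

fun path_exp :: "(nat \<Rightarrow> 'd::{finite,linorder} series \<Rightarrow> 'd series) \<Rightarrow> nat \<Rightarrow> 'd series \<Rightarrow> 'd series" where
  "path_exp D 0 f = f"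
| "path_exp D (Suc n) f = nat_inverse (Suc n) * (\<Sum>k\<le>n. path_exp D (n - k) (D (Suc k) f))"

text \<open>The recursion with its denominator cleared; this form includes n = 0, where both sides
  vanish.\<close>

lemma path_exp_rec: "of_nat n * path_exp D n f = (\<Sum>k<n. path_exp D (n - Suc k) (D (Suc k) f))"
proof (cases n)
  case (Suc m)
  have "of_nat n * path_exp D n f = (of_nat n * nat_inverse n) * (\<Sum>k\<le>m. path_exp D (m - k) (D (Suc k) f))"
    unfolding Suc path_exp.simps by (simp only: mult.assoc)
  also have "\<dots> = (\<Sum>k\<le>m. path_exp D (m - k) (D (Suc k) f))"
    using Suc by (subst of_nat_mult_nat_inverse) simp_all
  finally show ?thesis by (simp add: Suc lessThan_Suc_atMost)
qed simp

text \<open>The component of degree \<open>n\<close> sees only \<open>D 1\<close> to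
  \<open>D n\<close>, so the derivations can be chosen one after the other.\<close>

lemma path_exp_cong:
  "(\<And>k. 0 < k \<Longrightarrow> k \<le> n \<Longrightarrow> D k = D' k) \<Longrightarrow> path_exp D n f = path_exp D' n f"
proof (induction n arbitrary: f rule: less_induct)
  case (less n)
  show ?case
  proof (cases n)
    case (Suc m)
    have "path_exp D (m - k) (D (Suc k) f) = path_exp D' (m - k) (D' (Suc k) f)" if "k \<le> m" for k
      using less.IH[of "m - k"] less.prems that Suc by simp
    then show ?thesis by (simp add: Suc)
  qed simp
qed

text \<open>Keeping the derivations abstract allows these results to be applied to partly chosen
  sequences during the recursive construction as well as to the final one.\<close>

locale weight_raising_derivations =
  fixes \<alpha> :: "'d::{finite,linorder} \<Rightarrow> complex" and D :: "nat \<Rightarrow> 'd series \<Rightarrow> 'd series"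
  assumes D_add: "D k (f + g) = D k f + D k g"
    and D_mult: "D k (f * g) = D k f * g + f * D k g"
    and D_scalar: "D k (mps_const (scalar c)) = 0"
    and D_bracket: "D k (poisson_bracket f g) = poisson_bracket (D k f) g + poisson_bracket f (D k g)"
    and D_weight: "f \<in> weight_ge m \<Longrightarrow> D k f \<in> weight_ge (m + k)"
    and D_R: "f \<in> carrier (ring_R \<alpha>) \<Longrightarrow> D k f \<in> carrier (ring_R \<alpha>)"
begin

abbreviation "P \<equiv> path_exp D"

lemma P_add: "P n (f + g) = P n f + P n g"
proof (induction n arbitrary: f g rule: less_induct)
  case (less n)
  show ?case
  proof (cases n)
    case (Suc m)
    have "P (m - k) (D (Suc k) (f + g)) = P (m - k) (D (Suc k) f) + P (m - k) (D (Suc k) g)" if "k \<le> m" for k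
      using less.IH[of "m - k"] Suc by (simp add: D_add)
    then show ?thesis by (simp add: Suc sum.distrib distrib_left)
  qed simp
qed

lemma P_0: "P n 0 = 0"
  using P_add[of n 0 0] by simp

lemma P_scale: "P n (mps_const (scalar c) * f) = mps_const (scalar c) * P n f"
proof (induction n arbitrary: f rule: less_induct)
  case (less n)
  show ?case
  proof (cases n)
    case (Suc m)
    have "P (m - k) (D (Suc k) (mps_const (scalar c) * f)) = mps_const (scalar c) * P (m - k) (D (Suc k) f)" if "k \<le> m" for k
      using less.IH[of "m - k"] Suc by (simp add: D_mult D_scalar)
    then show ?thesis by (simp add: Suc sum_distrib_left mult.left_commute)
  qed simp
qed

text \<open>Each summand applies \<open>D (Suc k)\<close> and then a component of the complementary
  degree, so the gains in weight add up to \<open>n\<close>.\<close>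

lemma P_weight: "f \<in> weight_ge m \<Longrightarrow> P n f \<in> weight_ge (m + n)"
proof (induction n arbitrary: f m rule: less_induct)
  case (less n)
  show ?case
  proof (cases n)
    case (Suc l)
    have "P (l - k) (D (Suc k) f) \<in> weight_ge (m + n)" if "k \<le> l" for k
      using less.IH[of "l - k", OF _ D_weight[OF less.prems, of "Suc k"]] that Suc by simp
    then show ?thesis unfolding Suc path_exp.simps
      by (intro weight_ge_const_mult weight_ge_sum) (simp add: Suc)
  qed (use less.prems in simp)
qed

lemma P_R: "f \<in> carrier (ring_R \<alpha>) \<Longrightarrow> P n f \<in> carrier (ring_R \<alpha>)"
proof (induction n arbitrary: f rule: less_induct)
  case (less n)
  show ?case
  proof (cases n)
    case (Suc m)
    then show ?thesis unfolding Suc path_exp.simps using less Suc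
      by (intro ring_R_mult ring_R_const SD.scalar ring_R_sum less.IH D_R) auto
  qed (use less.prems in simp)
qed

text \<open>The multiplicativity of the exponential in degree \<open>n\<close>. It is stated for any
  biadditive operation with a Leibniz rule, to cover product and bracket at once.\<close>

lemma P_bilinear:
  assumes add_left: "\<And>f g h. B (f + g) h = B f h + B g h"
    and add_right: "\<And>f g h. B h (f + g) = B h f + B h g"
    and leibniz: "\<And>k f g. D k (B f g) = B (D k f) g + B f (D k g)"
  shows "P n (B f g) = (\<Sum>i\<le>n. B (P i f) (P (n - i) g))"
proof -
  have zero: "B 0 h = 0" "B h 0 = 0" for h
    using add_left[of 0 0 h] add_right[of h 0 0] by simp_all
  have nat: "B (of_nat m * f) g = of_nat m * B f g" "B f (of_nat m * g) = of_nat m * B f g" for m f g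
    by (induction m) (simp_all add: zero add_left add_right distrib_right)
  have sum: "B (sum u A) h = (\<Sum>x\<in>A. B (u x) h)" "B h (sum u A) = (\<Sum>x\<in>A. B h (u x))"
    for u :: "nat \<Rightarrow> _" and A h
    by (induction A rule: infinite_finite_induct) (simp_all add: zero add_left add_right)
  show ?thesis
  proof (induction n arbitrary: f g rule: less_induct)
    case (less n)
    show ?case
    proof (cases "n = 0")
      case False
      let ?X = "\<lambda>k i j. B (P i (D (Suc k) f)) (P j g)" and ?Y = "\<lambda>k i j. B (P i f) (P j (D (Suc k) g))"
      let ?S = "SIGMA k:{..<n}. {..n - Suc k}"
      \<comment> \<open>Writing n = i + (n - i) gives each factor its own degree as coefficient, so
        the recursion applies to both.\<close>
      have "of_nat n * (\<Sum>i\<le>n. B (P i f) (P (n - i) g))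
          = (\<Sum>i\<le>n. of_nat i * B (P i f) (P (n - i) g) + of_nat (n - i) * B (P i f) (P (n - i) g))"
        unfolding sum_distrib_left
        by (rule sum.cong) (simp_all add: distrib_right[symmetric] flip: of_nat_add)
      also have "\<dots> = (\<Sum>i\<le>n. \<Sum>k<i. ?X k (i - Suc k) (n - i)) + (\<Sum>i\<le>n. \<Sum>k<n - i. ?Y k i (n - i - Suc k))"
      proof -
        have "of_nat i * B (P i f) (P (n - i) g) = (\<Sum>k<i. ?X k (i - Suc k) (n - i))" for i
          by (simp only: nat(1)[symmetric] path_exp_rec sum(1))
        moreover have "of_nat (n - i) * B (P i f) (P (n - i) g) = (\<Sum>k<n - i. ?Y k i (n - i - Suc k))" for i
          by (simp only: nat(2)[symmetric] path_exp_rec sum(2))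
        ultimately show ?thesis by (simp only: sum.distrib)
      qed
      \<comment> \<open>Both double sums are brought over \<open>?S\<close>: first the index of the
        derivation, then the splitting of the remaining degree, to which the induction hypothesis
        applies.\<close>
      also have "(\<Sum>i\<le>n. \<Sum>k<i. ?X k (i - Suc k) (n - i)) = (\<Sum>(k, i)\<in>?S. ?X k i (n - Suc k - i))"
        unfolding sum.Sigma[OF finite_atMost ballI[OF finite_lessThan]]
        by (rule sum.reindex_bij_witness[of _ "\<lambda>(k, i). (i + Suc k, k)" "\<lambda>(i, k). (k, i - Suc k)"])
          (auto simp: algebra_simps)
      also have "(\<Sum>i\<le>n. \<Sum>k<n - i. ?Y k i (n - i - Suc k)) = (\<Sum>(k, i)\<in>?S. ?Y k i (n - Suc k - i))"
        unfolding sum.Sigma[OF finite_atMost ballI[OF finite_lessThan]]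
        by (rule sum.reindex_bij_witness[of _ "\<lambda>(k, i). (i, k)" "\<lambda>(i, k). (k, i)"])
          (auto simp: algebra_simps)
      also have "(\<Sum>(k, i)\<in>?S. ?X k i (n - Suc k - i)) + (\<Sum>(k, i)\<in>?S. ?Y k i (n - Suc k - i))
          = (\<Sum>k<n. (\<Sum>i\<le>n - Suc k. ?X k i (n - Suc k - i)) + (\<Sum>i\<le>n - Suc k. ?Y k i (n - Suc k - i)))"
        by (simp only: sum.Sigma[OF finite_lessThan ballI[OF finite_atMost], symmetric] sum.distrib)
      also have "\<dots> = (\<Sum>k<n. P (n - Suc k) (D (Suc k) (B f g)))"
        by (rule sum.cong) (simp_all add: leibniz P_add less.IH)
      also have "\<dots> = of_nat n * P n (B f g)"
        by (simp only: path_exp_rec)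
      finally show ?thesis using of_nat_mult_cancel[of n "P n (B f g)"] False by simp
    qed simp
  qed
qed

section \<open>Summation of the components to a Poisson automorphism\<close>

definition path_automorphism :: "'d series \<Rightarrow> 'd series" where
  "path_automorphism f = weight_series (\<lambda>n. P n f)"

lemma path_automorphism_approx: "path_automorphism f - (\<Sum>n\<le>N. P n f) \<in> weight_ge (Suc N)"
  unfolding path_automorphism_def
  by (rule weight_series_approx) (use P_weight[of f 0] in simp)

lemma path_automorphism_add: "path_automorphism (f + g) = path_automorphism f + path_automorphism g"
  by (rule mps_eqI) (simp add: path_automorphism_def mps_coeff_weight_series P_add mps_coeff_simps sum.distrib)

lemma path_automorphism_scale:
  "path_automorphism (mps_const (scalar c) * f) = mps_const (scalar c) * path_automorphism f"
  by (rule mps_eqI) (simp add: path_automorphism_def mps_coeff_weight_series P_scale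
      mps_coeff_const_mult sum_distrib_left)

lemma path_automorphism_R: "f \<in> carrier (ring_R \<alpha>) \<Longrightarrow> path_automorphism f \<in> carrier (ring_R \<alpha>)"
  unfolding path_automorphism_def by (intro ring_R_weight_series P_R)

text \<open>The operation may lower the weight by 2, as the bracket does. The claim is checked
  modulo each weight by comparing truncated sums.\<close>

lemma path_automorphism_bilinear:
  assumes add_left: "\<And>f g h. B (f + g) h = B f h + B g h"
    and add_right: "\<And>f g h. B h (f + g) = B h f + B h g"
    and leibniz: "\<And>k f g. D k (B f g) = B (D k f) g + B f (D k g)"
    and weight: "\<And>f g m n. f \<in> weight_ge m \<Longrightarrow> g \<in> weight_ge n \<Longrightarrow> B f g \<in> weight_ge (m + n - 2)"
  shows "path_automorphism (B f g) = B (path_automorphism f) (path_automorphism g)"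
proof (rule weight_ge_eqI)
  fix m
  \<comment> \<open>With this choice Suc N - 2 = m, which makes up for the possible loss of
    weight.\<close>
  define N where "N = Suc m"
  have zero: "B 0 h = 0" "B h 0 = 0" for h
    using add_left[of 0 0 h] add_right[of h 0 0] by simp_all
  have sum: "B (sum u A) h = (\<Sum>x\<in>A. B (u x) h)" "B h (sum u A) = (\<Sum>x\<in>A. B h (u x))"
    for u :: "nat \<Rightarrow> _" and A h
    by (induction A rule: infinite_finite_induct) (simp_all add: zero add_left add_right)
  let ?a = "\<Sum>i\<le>N. P i f" and ?b = "\<Sum>i\<le>N. P i g"
  define f' where "f' = path_automorphism f - ?a"
  define g' where "g' = path_automorphism g - ?b"
  have f': "f' \<in> weight_ge (Suc N)" and g': "g' \<in> weight_ge (Suc N)"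
    unfolding f'_def g'_def by (rule path_automorphism_approx)+
  have low: "h \<in> weight_ge m" if "h \<in> weight_ge (Suc N - 2)" for h
    using that by (simp add: N_def)
  have "B (path_automorphism f) (path_automorphism g) = B (f' + ?a) (path_automorphism g)"
    by (simp add: f'_def)
  also have "\<dots> = B f' (path_automorphism g) + B ?a (g' + ?b)"
    by (simp only: add_left) (simp add: g'_def)
  also have "\<dots> = B f' (path_automorphism g) + B ?a g' + B ?a ?b"
    by (simp add: add_right add.assoc)
  finally have 1: "B (path_automorphism f) (path_automorphism g) - B ?a ?b = B f' (path_automorphism g) + B ?a g'"
    by simp
  have "B (path_automorphism f) (path_automorphism g) - B ?a ?b \<in> weight_ge m"
    unfolding 1 using weight[OF f' weight_ge_0, of "path_automorphism g"] weight[OF weight_ge_0 g', of ?a]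
    by (intro weight_ge_add low) simp_all
  \<comment> \<open>Expanding \<open>B ?a ?b\<close> gives a square of index pairs, the components
    up to degree N a triangle. The leftover pairs have i + j > N, hence weight at least m.\<close>
  moreover have "B ?a ?b - (\<Sum>n\<le>N. P n (B f g)) \<in> weight_ge m"
  proof -
    have "(\<Sum>n\<le>N. P n (B f g)) = (\<Sum>n\<le>N. \<Sum>i\<le>n. B (P i f) (P (n - i) g))"
      by (simp only: P_bilinear[OF add_left add_right leibniz])
    also have "\<dots> = (\<Sum>i\<le>N. \<Sum>j\<le>N - i. B (P i f) (P j g))"
      unfolding sum.Sigma[OF finite_atMost ballI[OF finite_atMost]]
      by (rule sum.reindex_bij_witness[of _ "\<lambda>(i, j). (i + j, i)" "\<lambda>(n, i). (i, n - i)"]) auto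
    finally have "B ?a ?b - (\<Sum>n\<le>N. P n (B f g))
        = (\<Sum>i\<le>N. (\<Sum>j\<le>N. B (P i f) (P j g)) - (\<Sum>j\<le>N - i. B (P i f) (P j g)))"
      unfolding sum_subtractf by (simp only: sum(1)) (simp only: sum(2))
    also have "\<dots> = (\<Sum>i\<le>N. \<Sum>j\<in>{..N} - {..N - i}. B (P i f) (P j g))"
      by (rule sum.cong) (auto simp: sum_diff)
    also have "\<dots> \<in> weight_ge m"
    proof (intro weight_ge_sum low)
      fix i j assume "i \<in> {..N}" "j \<in> {..N} - {..N - i}"
      then have "Suc N - 2 \<le> i + j - 2" by auto
      then show "B (P i f) (P j g) \<in> weight_ge (Suc N - 2)"
        using weight[OF P_weight[OF weight_ge_0] P_weight[OF weight_ge_0], of i f j g]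
        by (auto intro: weight_ge_mono)
    qed
    finally show ?thesis .
  qed
  ultimately have "B (path_automorphism f) (path_automorphism g) - (\<Sum>n\<le>N. P n (B f g)) \<in> weight_ge m"
    by (rule weight_ge_limit)
  moreover have "path_automorphism (B f g) - (\<Sum>n\<le>N. P n (B f g)) \<in> weight_ge m"
    by (rule weight_ge_mono[OF path_automorphism_approx]) (simp add: N_def)
  ultimately show "path_automorphism (B f g) - B (path_automorphism f) (path_automorphism g) \<in> weight_ge m"
    using weight_ge_diff[of "path_automorphism (B f g) - (\<Sum>n\<le>N. P n (B f g))" m
        "B (path_automorphism f) (path_automorphism g) - (\<Sum>n\<le>N. P n (B f g))"] by simp
qed

text \<open>All components except the identity raise the weight, which makes the map invertible by
  the Neumann series.\<close>

lemma path_automorphism_minus_id_weight: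
  assumes "f \<in> weight_ge m"
  shows "path_automorphism f - f \<in> weight_ge (Suc m)"
proof (rule weight_geI)
  fix k :: "'d var \<Rightarrow>\<^sub>0 nat" assume k: "weight k < Suc m"
  have "mps_coeff (P n f) k = 0" if "n \<noteq> 0" for n
    using weight_geD[OF P_weight[OF assms, of n]] k that by simp
  then have "(\<Sum>n\<le>weight k. mps_coeff (P n f) k) = (\<Sum>n\<in>{0}. mps_coeff (P n f) k)"
    by (intro sum.mono_neutral_right) auto
  then show "mps_coeff (path_automorphism f - f) k = 0"
    by (simp add: path_automorphism_def mps_coeff_weight_series mps_coeff_simps)
qed

lemma poisson_automorphism_path_automorphism: "poisson_automorphism \<alpha> path_automorphism"
proof -
  have mult: "path_automorphism (f * g) = path_automorphism f * path_automorphism g" for f g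
    by (rule path_automorphism_bilinear)
      (simp_all add: distrib_left distrib_right D_mult weight_ge_mono[OF weight_ge_mult])
  have bracket: "path_automorphism (poisson_bracket f g)
      = poisson_bracket (path_automorphism f) (path_automorphism g)" for f g
    by (rule path_automorphism_bilinear)
      (simp_all add: poisson_bracket_add_left poisson_bracket_add_right D_bracket weight_ge_poisson_bracket)
  have "D k 1 = 0" for k using D_scalar[of k 1] by (simp add: scalar_1)
  then have "mps_coeff (P n 1) k = (if n = 0 then mps_coeff 1 k else 0)" for n k
    by (cases n) (simp_all add: P_0 mps_coeff_simps)
  then have one: "path_automorphism 1 = 1"
    by (intro mps_eqI) (simp add: path_automorphism_def mps_coeff_weight_series)
  have "bij_betw (\<lambda>f. f + (path_automorphism f - f)) (carrier (ring_R \<alpha>)) (carrier (ring_R \<alpha>))"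
    by (rule bij_betw_id_plus_weight_raising)
      (simp_all add: path_automorphism_add path_automorphism_minus_id_weight ring_R_diff path_automorphism_R)
  then have "bij_betw path_automorphism (carrier (ring_R \<alpha>)) (carrier (ring_R \<alpha>))" by simp
  moreover have "path_automorphism \<in> ring_hom (ring_R \<alpha>) (ring_R \<alpha>)"
    by (rule ring_hom_memI) (use path_automorphism_R in \<open>auto simp: ring_R_def mult one path_automorphism_add\<close>)
  ultimately show ?thesis
    unfolding poisson_automorphism_def ring_iso_def
    by (simp add: path_automorphism_scale bracket)
qed

end

section \<open>Expansion in powers of the Moser generators\<close>

lemma sum_UNIV_var:
  "(\<Sum>v\<in>UNIV. h v) = (\<Sum>i\<in>UNIV. h (TauVar i) + h (QVar i) + h (PVar i))"
  for h :: "'d::finite var \<Rightarrow> 'b::comm_monoid_add"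
proof -
  have "x \<in> range TauVar \<union> range QVar \<union> range PVar" for x :: "'d var"
    by (cases x) auto
  then have U: "(UNIV :: 'd var set) = range TauVar \<union> range QVar \<union> range PVar" by blast
  have "(\<Sum>v\<in>UNIV. h v) = sum h (range TauVar) + sum h (range QVar) + sum h (range PVar)"
    unfolding U by (subst sum.union_disjoint; (subst sum.union_disjoint)?; auto)
  also have "\<dots> = (\<Sum>i\<in>UNIV. h (TauVar i)) + (\<Sum>i\<in>UNIV. h (QVar i)) + (\<Sum>i\<in>UNIV. h (PVar i))"
    by (simp add: sum.reindex inj_def)
  finally show ?thesis by (simp add: sum.distrib)
qed

lemma prod_UNIV_var:
  "(\<Prod>v\<in>UNIV. h v) = (\<Prod>i\<in>UNIV. h (TauVar i) * h (QVar i) * h (PVar i))"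
  for h :: "'d::finite var \<Rightarrow> 'b::comm_monoid_mult"
proof -
  have "x \<in> range TauVar \<union> range QVar \<union> range PVar" for x :: "'d var"
    by (cases x) auto
  then have U: "(UNIV :: 'd var set) = range TauVar \<union> range QVar \<union> range PVar" by blast
  have "(\<Prod>v\<in>UNIV. h v) = prod h (range TauVar) * prod h (range QVar) * prod h (range PVar)"
    unfolding U by (subst prod.union_disjoint; (subst prod.union_disjoint)?; auto)
  also have "\<dots> = (\<Prod>i\<in>UNIV. h (TauVar i)) * (\<Prod>i\<in>UNIV. h (QVar i)) * (\<Prod>i\<in>UNIV. h (PVar i))"
    by (simp add: prod.reindex inj_def)
  finally show ?thesis by (simp add: prod.distrib)
qed

lemma sum_single_lookup: "(\<Sum>v\<in>UNIV. Poly_Mapping.single v (Poly_Mapping.lookup x v)) = (x :: 'v::finite \<Rightarrow>\<^sub>0 nat)"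
proof (rule poly_mapping_eqI)
  fix w
  have "(\<Sum>v\<in>UNIV. Poly_Mapping.lookup (Poly_Mapping.single v (Poly_Mapping.lookup x v)) w)
      = (\<Sum>v\<in>UNIV. if v = w then Poly_Mapping.lookup x v else 0)"
    by (rule sum.cong) (auto simp: lookup_single)
  then show "Poly_Mapping.lookup (\<Sum>v\<in>UNIV. Poly_Mapping.single v (Poly_Mapping.lookup x v)) w = Poly_Mapping.lookup x w"
    by (simp add: lookup_sum)
qed

lemma mps_var_power: "mps_var v ^ n = (mps_monom (Poly_Mapping.single v n) 1 :: ('v, 'a::comm_ring_1) mps)"
proof (induction n)
  case (Suc n)
  then show ?case
    by (simp add: mps_var_eq_monom mps_monom_mult single_add[symmetric])
qed (simp add: mps_one_eq_monom)

lemma mps_monom_prod: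
  "(\<Prod>i\<in>A. mps_monom (x i) 1) = (mps_monom (sum x A) 1 :: ('v, 'a::comm_ring_1) mps)"
  by (induction A rule: infinite_finite_induct) (simp_all add: mps_one_eq_monom mps_monom_mult)

lemma mps_monom_eq_prod:
  "mps_monom x 1 = (\<Prod>v\<in>UNIV. mps_var v ^ Poly_Mapping.lookup (x :: 'v::finite \<Rightarrow>\<^sub>0 nat) v :: ('v, 'a::comm_ring_1) mps)"
  by (simp only: mps_var_power mps_monom_prod sum_single_lookup)

lemma mps_monom_eq_const_mult: "mps_monom x c = mps_const c * (mps_monom x 1 :: ('v, 'a::comm_ring_1) mps)"
  by (simp add: mps_const_eq_monom mps_monom_mult)

subsection \<open>The Poisson centre\<close>

lemma ring_R0_iff:
  "f \<in> ring_R0 \<alpha> \<longleftrightarrow> f \<in> carrier (ring_R \<alpha>) \<and> (\<forall>k. mps_coeff f k \<noteq> 0 \<longrightarrow> Poly_Mapping.keys k \<subseteq> range TauVar)"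
  by (simp add: ring_R0_def)

lemma ring_R0_zero: "0 \<in> ring_R0 \<alpha>"
  by (simp add: ring_R0_iff ring_R_zero zero_mps.rep_eq)

lemma ring_R0_uminus: "f \<in> ring_R0 \<alpha> \<Longrightarrow> - f \<in> ring_R0 \<alpha>"
  by (simp add: ring_R0_iff ring_R_uminus uminus_mps.rep_eq)

lemma ring_R0_const: "c \<in> SD \<alpha> \<Longrightarrow> mps_const c \<in> ring_R0 \<alpha>"
  by (simp add: ring_R0_iff ring_R_const mps_const.rep_eq)

lemma ring_R0_of_nat: "of_nat n \<in> ring_R0 \<alpha>"
  by (simp add: of_nat_eq_mps_const ring_R0_const SD_of_nat)

lemma ring_R0_mult:
  assumes "f \<in> ring_R0 \<alpha>" "g \<in> ring_R0 \<alpha>"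
  shows "f * g \<in> ring_R0 \<alpha>"
proof -
  have "Poly_Mapping.keys k \<subseteq> range TauVar" if k: "mps_coeff (f * g) k \<noteq> 0" for k
  proof -
    obtain x where x: "fst x + snd x = k" "mps_coeff f (fst x) * mps_coeff g (snd x) \<noteq> 0"
      using k unfolding mps_coeff_times by (metis (mono_tags, lifting) mem_Collect_eq sum.neutral)
    then have "Poly_Mapping.keys (fst x) \<subseteq> range TauVar" "Poly_Mapping.keys (snd x) \<subseteq> range TauVar"
      using assms by (auto simp: ring_R0_iff)
    then show ?thesis using x(1) keys_add[of "fst x" "snd x"] by blast
  qed
  then show ?thesis using assms by (simp add: ring_R0_iff ring_R_mult)
qed

lemma ring_R0_tau: "mps_var (TauVar i) \<in> ring_R0 \<alpha>"
  by (simp add: ring_R0_iff ring_R_var mps_var.rep_eq)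

lemma ring_R0_one: "1 \<in> ring_R0 \<alpha>"
  using ring_R0_of_nat[of 1] by simp

lemma ring_R0_power: "f \<in> ring_R0 \<alpha> \<Longrightarrow> f ^ n \<in> ring_R0 \<alpha>"
  by (induction n) (simp_all add: ring_R0_mult ring_R0_one)

lemma ring_R0_prod: "(\<And>x. x \<in> A \<Longrightarrow> f x \<in> ring_R0 \<alpha>) \<Longrightarrow> prod f A \<in> ring_R0 \<alpha>"
  by (induction A rule: infinite_finite_induct) (simp_all add: ring_R0_mult ring_R0_one)

subsection \<open>Coefficients of the expansion\<close>

text \<open>These are the monomials in the \<tau>_i and the products p_i q_i: on them
  \<open>frequency \<alpha>\<close> vanishes, on all others it is a nonzero small
  denominator.\<close>

definition balanced :: "('d var \<Rightarrow>\<^sub>0 nat) \<Rightarrow> bool" where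
  "balanced x \<longleftrightarrow> (\<forall>i. Poly_Mapping.lookup x (QVar i) = Poly_Mapping.lookup x (PVar i))"

definition total_degree :: "('d::finite \<Rightarrow>\<^sub>0 nat) \<Rightarrow> nat" where
  "total_degree j = (\<Sum>i\<in>UNIV. Poly_Mapping.lookup j i)"

definition moser_power :: "('d::{finite,linorder} \<Rightarrow>\<^sub>0 nat) \<Rightarrow> 'd series" where
  "moser_power j = (\<Prod>i\<in>UNIV. moser_gen i ^ Poly_Mapping.lookup j i)"

text \<open>The coefficient of \<open>f^j\<close> in the binomial expansion of a monomial, using \<open>p\<^sub>i q\<^sub>i = f\<^sub>i + \<tau>\<^sub>i\<close>.\<close>

definition moser_term :: "('d::{finite,linorder} \<Rightarrow>\<^sub>0 nat) \<Rightarrow> ('d var \<Rightarrow>\<^sub>0 nat) \<Rightarrow> 'd series" where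
  "moser_term j x = (if balanced x \<and> (\<forall>i. Poly_Mapping.lookup j i \<le> Poly_Mapping.lookup x (QVar i))
     then \<Prod>i\<in>UNIV. of_nat (Poly_Mapping.lookup x (QVar i) choose Poly_Mapping.lookup j i) *
       mps_var (TauVar i) ^ (Poly_Mapping.lookup x (TauVar i) + (Poly_Mapping.lookup x (QVar i) - Poly_Mapping.lookup j i))
     else 0)"

text \<open>The cutoff discards only zero terms, because \<open>moser_term j x\<close> has weight at least \<open>weight x - 2 |j|\<close>.\<close>

definition moser_coeff :: "('d::{finite,linorder} \<Rightarrow>\<^sub>0 nat) \<Rightarrow> 'd series \<Rightarrow> 'd series" where
  "moser_coeff j f = Abs_mps (\<lambda>m. \<Sum>x | weight x \<le> weight m + 2 * total_degree j.
     mps_coeff f x * mps_coeff (moser_term j x) m)"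

lemma mps_coeff_moser_coeff:
  "mps_coeff (moser_coeff j f) m = (\<Sum>x | weight x \<le> weight m + 2 * total_degree j.
     mps_coeff f x * mps_coeff (moser_term j x) m)"
  by (simp add: moser_coeff_def Abs_mps_inverse)

lemma weight_ge_moser_gen: "moser_gen i \<in> weight_ge 2"
  unfolding moser_gen_def
  using weight_ge_mult[OF weight_ge_var[of "PVar i"] weight_ge_var[of "QVar i"]] weight_ge_var[of "TauVar i"]
  by (intro weight_ge_diff) (simp_all add: numeral_2_eq_2)

lemma weight_ge_moser_power: "moser_power j \<in> weight_ge (2 * total_degree j)"
proof -
  have "moser_power j \<in> weight_ge (\<Sum>i\<in>UNIV. Poly_Mapping.lookup j i * 2)"
    unfolding moser_power_def by (intro weight_ge_prod weight_ge_power weight_ge_moser_gen) simp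
  then show ?thesis by (simp add: total_degree_def sum_distrib_left mult.commute)
qed

lemma ring_R_moser_power: "moser_power j \<in> carrier (ring_R \<alpha>)"
  unfolding moser_power_def by (intro ring_R_prod ring_R_power moser_gen_in_R)

lemma moser_power_add: "moser_power (j + l) = moser_power j * moser_power l"
  by (simp add: moser_power_def lookup_add power_add prod.distrib)

lemma moser_power_single: "moser_power (Poly_Mapping.single i 1) = moser_gen i"
proof -
  have "moser_power (Poly_Mapping.single i 1) = (\<Prod>l\<in>UNIV. if i = l then moser_gen l else 1)"
    unfolding moser_power_def by (rule prod.cong) (auto simp: lookup_single)
  then show ?thesis by simp
qed

lemma moser_power_0 [simp]: "moser_power 0 = 1"
  by (simp add: moser_power_def)

text \<open>In a nonzero term each pair p_i q_i has become either \<tau>_i, of the same weight 2, or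
  a factor f_i, which is split off.\<close>

lemma weight_ge_moser_term: "moser_term j x \<in> weight_ge (weight x - 2 * total_degree j)"
proof (cases "balanced x \<and> (\<forall>i. Poly_Mapping.lookup j i \<le> Poly_Mapping.lookup x (QVar i))")
  case True
  let ?e = "\<lambda>i. Poly_Mapping.lookup x (TauVar i) + (Poly_Mapping.lookup x (QVar i) - Poly_Mapping.lookup j i)"
  have t: "of_nat n * mps_var (TauVar i) ^ m \<in> weight_ge (m * 2)" for n m and i :: 'a
    unfolding of_nat_eq_mps_const using weight_ge_power[OF weight_ge_var[of "TauVar i"], of m]
    by (intro weight_ge_const_mult) simp
  have "(\<Prod>i\<in>UNIV. of_nat (Poly_Mapping.lookup x (QVar i) choose Poly_Mapping.lookup j i) *
      mps_var (TauVar i) ^ ?e i) \<in> weight_ge (\<Sum>i\<in>UNIV. ?e i * 2)"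
    by (intro weight_ge_prod t) simp
  then have "moser_term j x \<in> weight_ge (\<Sum>i\<in>UNIV. ?e i * 2)"
    unfolding moser_term_def if_P[OF True] .
  moreover have "weight x = (\<Sum>i\<in>UNIV. ?e i * 2) + 2 * total_degree j"
    unfolding weight_eq_sum sum_UNIV_var total_degree_def sum_distrib_left sum.distrib[symmetric]
  proof (rule sum.cong)
    fix i
    have "Poly_Mapping.lookup x (PVar i) = Poly_Mapping.lookup x (QVar i)"
      "Poly_Mapping.lookup j i \<le> Poly_Mapping.lookup x (QVar i)"
      using True by (auto simp: balanced_def)
    then show "Poly_Mapping.lookup x (TauVar i) * var_weight (TauVar i) + Poly_Mapping.lookup x (QVar i) * var_weight (QVar i)
        + Poly_Mapping.lookup x (PVar i) * var_weight (PVar i) = ?e i * 2 + 2 * Poly_Mapping.lookup j i"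
      by simp
  qed simp
  ultimately show ?thesis by simp
qed (auto simp: moser_term_def)

lemma ring_R0_moser_term: "moser_term j x \<in> ring_R0 \<alpha>"
  unfolding moser_term_def
  by (auto intro!: ring_R0_prod ring_R0_mult ring_R0_of_nat ring_R0_power ring_R0_tau ring_R0_zero)

lemma moser_coeff_add: "moser_coeff j (f + g) = moser_coeff j f + moser_coeff j g"
  by (rule mps_eqI) (simp add: mps_coeff_moser_coeff mps_coeff_simps distrib_right sum.distrib)

lemma moser_coeff_0 [simp]: "moser_coeff j 0 = 0"
  by (rule mps_eqI) (simp add: mps_coeff_moser_coeff mps_coeff_simps)

lemma moser_coeff_diff: "moser_coeff j (f - g) = moser_coeff j f - moser_coeff j g"
  using moser_coeff_add[of j "f - g" g] by simp

lemma moser_coeff_sum: "moser_coeff j (sum u A) = (\<Sum>x\<in>A. moser_coeff j (u x))"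
  by (induction A rule: infinite_finite_induct) (simp_all add: moser_coeff_add)

lemma moser_coeff_weight:
  assumes "f \<in> weight_ge n"
  shows "moser_coeff j f \<in> weight_ge (n - 2 * total_degree j)"
proof (rule weight_geI)
  fix m :: "'a var \<Rightarrow>\<^sub>0 nat" assume "weight m < n - 2 * total_degree j"
  then have "mps_coeff f x = 0" if "weight x \<le> weight m + 2 * total_degree j" for x
    using that by (intro weight_geD[OF assms]) linarith
  then show "mps_coeff (moser_coeff j f) m = 0"
    by (simp add: mps_coeff_moser_coeff)
qed

lemma moser_coeff_monom: "moser_coeff j (mps_monom x c) = mps_const c * moser_term j x"
proof (rule mps_eqI)
  fix m
  have "mps_coeff (moser_coeff j (mps_monom x c)) m
      = (\<Sum>y | weight y \<le> weight m + 2 * total_degree j. if y = x then c * mps_coeff (moser_term j x) m else 0)"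
    unfolding mps_coeff_moser_coeff by (rule sum.cong) (auto simp: mps_coeff_monom)
  also have "\<dots> = (if weight x \<le> weight m + 2 * total_degree j then c * mps_coeff (moser_term j x) m else 0)"
    by (simp add: finite_weight_le)
  also have "\<dots> = c * mps_coeff (moser_term j x) m"
    using weight_geD[OF weight_ge_moser_term[of j x], of m] by auto
  finally show "mps_coeff (moser_coeff j (mps_monom x c)) m = mps_coeff (mps_const c * moser_term j x) m"
    by (simp add: mps_coeff_const_mult)
qed

lemma ring_R0_moser_coeff:
  assumes "f \<in> carrier (ring_R \<alpha>)"
  shows "moser_coeff j f \<in> ring_R0 \<alpha>"
proof -
  have t: "mps_coeff (moser_term j x) m \<in> SD \<alpha>"
    "mps_coeff (moser_term j x) m \<noteq> 0 \<Longrightarrow> Poly_Mapping.keys m \<subseteq> range TauVar" for x m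
    using ring_R0_moser_term[of j x \<alpha>] by (auto simp: ring_R0_iff ring_R_iff)
  have "mps_coeff (moser_coeff j f) m \<in> SD \<alpha>" for m
    unfolding mps_coeff_moser_coeff using assms t(1) by (intro SD_sum SD.mult) (auto simp: ring_R_iff)
  moreover have "Poly_Mapping.keys m \<subseteq> range TauVar" if m: "mps_coeff (moser_coeff j f) m \<noteq> 0" for m
  proof (rule ccontr)
    assume "\<not> Poly_Mapping.keys m \<subseteq> range TauVar"
    then have "mps_coeff (moser_term j x) m = 0" for x using t(2) by blast
    then show False using m by (simp add: mps_coeff_moser_coeff)
  qed
  ultimately show ?thesis by (simp add: ring_R0_iff ring_R_iff)
qed

text \<open>Unbalanced monomials have zero \<open>moser_term\<close>, so removing them by a
  Hamiltonian derivation leaves the expansion in the f_i unchanged.\<close>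

lemma moser_coeff_balanced_cong:
  assumes "\<And>x. balanced x \<Longrightarrow> mps_coeff f x = mps_coeff g x"
  shows "moser_coeff j f = moser_coeff j g"
proof (rule mps_eqI)
  fix m
  have eq: "mps_coeff f x * mps_coeff (moser_term j x) m = mps_coeff g x * mps_coeff (moser_term j x) m" for x
    using assms[of x] by (cases "balanced x") (auto simp: moser_term_def zero_mps.rep_eq)
  show "mps_coeff (moser_coeff j f) m = mps_coeff (moser_coeff j g) m"
    by (simp only: mps_coeff_moser_coeff eq)
qed

lemma lookup_le_total_degree: "Poly_Mapping.lookup j i \<le> total_degree j"
  unfolding total_degree_def by (rule member_le_sum) auto

lemma finite_total_degree_le: "finite {j :: 'd::finite \<Rightarrow>\<^sub>0 nat. total_degree j \<le> n}"
proof (rule finite_subset)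
  let ?b = "Abs_poly_mapping (\<lambda>_ :: 'd. n)"
  have "Poly_Mapping.lookup ?b = (\<lambda>_. n)" by (rule Abs_poly_mapping_inverse) simp
  then show "{j :: 'd \<Rightarrow>\<^sub>0 nat. total_degree j \<le> n} \<subseteq> {j. \<forall>i. Poly_Mapping.lookup j i \<le> Poly_Mapping.lookup ?b i}"
    by (auto intro: order_trans[OF lookup_le_total_degree])
qed (rule finite_poly_mapping_below)

text \<open>The binomial theorem for p_i q_i = f_i + \<tau>_i in each variable, with the product of
  sums expanded over all choices of exponents.\<close>

lemma moser_expansion_monom:
  fixes x :: "'d::{finite,linorder} var \<Rightarrow>\<^sub>0 nat"
  assumes bal: "balanced x" and N: "weight x \<le> N"
  shows "mps_monom x 1 = (\<Sum>j | total_degree j \<le> N. moser_term j x * moser_power j)"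
proof -
  let ?k = "\<lambda>i. Poly_Mapping.lookup x (QVar i)" and ?a = "\<lambda>i. Poly_Mapping.lookup x (TauVar i)"
  define h :: "'d \<Rightarrow> nat \<Rightarrow> 'd series" where
    "h i l = of_nat (?k i choose l) * mps_var (TauVar i) ^ (?a i + (?k i - l)) * moser_gen i ^ l" for i l
  have "mps_monom x 1 = (\<Prod>i\<in>UNIV. mps_var (TauVar i) ^ ?a i * (moser_gen i + mps_var (TauVar i)) ^ ?k i)"
    unfolding mps_monom_eq_prod prod_UNIV_var
    using bal by (intro prod.cong) (simp_all add: balanced_def moser_gen_def power_mult_distrib ac_simps)
  also have "\<dots> = (\<Prod>i\<in>UNIV. \<Sum>l\<le>?k i. h i l)"
    by (rule prod.cong) (simp_all only: binomial_ring h_def sum_distrib_left power_add ac_simps)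
  also have "\<dots> = (\<Sum>g\<in>PiE UNIV (\<lambda>i. {..?k i}). \<Prod>i\<in>UNIV. h i (g i))"
    by (rule prod_sum_PiE) auto
  also have "\<dots> = (\<Sum>j | \<forall>i. Poly_Mapping.lookup j i \<le> ?k i. \<Prod>i\<in>UNIV. h i (Poly_Mapping.lookup j i))"
    by (rule sum.reindex_bij_witness[of _ Poly_Mapping.lookup Abs_poly_mapping])
      (auto simp: Abs_poly_mapping_inverse lookup_inverse PiE_def Pi_def)
  also have "\<dots> = (\<Sum>j | \<forall>i. Poly_Mapping.lookup j i \<le> ?k i. moser_term j x * moser_power j)"
    using bal by (intro sum.cong) (simp_all add: moser_term_def moser_power_def h_def prod.distrib)
  \<comment> \<open>The enlarged index set adds only zero terms; being independent of
    \<open>x\<close>, it allows the sum over monomials to be exchanged with it.\<close>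
  also have "\<dots> = (\<Sum>j | total_degree j \<le> N. moser_term j x * moser_power j)"
  proof (rule sum.mono_neutral_left)
    have "total_degree j \<le> N" if "\<forall>i. Poly_Mapping.lookup j i \<le> ?k i" for j
    proof -
      have "total_degree j \<le> (\<Sum>i\<in>UNIV. ?k i)"
        unfolding total_degree_def using that by (intro sum_mono) auto
      also have "\<dots> \<le> weight x"
        unfolding weight_eq_sum sum_UNIV_var by (intro sum_mono) simp
      finally show ?thesis using N by simp
    qed
    then show "{j. \<forall>i. Poly_Mapping.lookup j i \<le> ?k i} \<subseteq> {j. total_degree j \<le> N}" by blast
  qed (auto simp: finite_total_degree_le moser_term_def)
  finally show ?thesis .
qed

text \<open>The expansion is exact on the polynomial part of weight at most N. On the remainder, the
  weight 2 |j| lost by \<open>moser_coeff j\<close> is regained by the factor f^j.\<close>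

lemma moser_expansion:
  assumes bal: "\<And>x. mps_coeff f x \<noteq> 0 \<Longrightarrow> balanced x"
  shows "f - (\<Sum>j | total_degree j \<le> N. moser_coeff j f * moser_power j) \<in> weight_ge (Suc N)"
proof -
  let ?t = "\<Sum>x | weight x \<le> N. mps_monom x (mps_coeff f x)"
  let ?J = "{j. total_degree j \<le> N}"
  have d: "f - ?t \<in> weight_ge (Suc N)" by (rule diff_sum_monom_weight_ge)
  have "moser_coeff j (f - ?t) * moser_power j \<in> weight_ge (Suc N)" for j
    using weight_ge_mult[OF moser_coeff_weight[OF d, of j] weight_ge_moser_power[of j]]
    by (rule weight_ge_mono) simp
  then have "(\<Sum>j\<in>?J. moser_coeff j (f - ?t) * moser_power j) \<in> weight_ge (Suc N)"
    by (intro weight_ge_sum)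
  moreover have "?t = (\<Sum>j\<in>?J. moser_coeff j ?t * moser_power j)"
  proof -
    have "mps_monom x (mps_coeff f x) = (\<Sum>j\<in>?J. moser_coeff j (mps_monom x (mps_coeff f x)) * moser_power j)"
      if x: "weight x \<le> N" for x
    proof (cases "mps_coeff f x = 0")
      case True
      then show ?thesis by (simp add: mps_monom_eq_const_mult[of x 0] moser_coeff_monom)
    next
      case False
      have "mps_monom x (mps_coeff f x) = mps_const (mps_coeff f x) * (\<Sum>j\<in>?J. moser_term j x * moser_power j)"
        by (subst mps_monom_eq_const_mult) (simp only: moser_expansion_monom[OF bal[OF False] x])
      also have "\<dots> = (\<Sum>j\<in>?J. moser_coeff j (mps_monom x (mps_coeff f x)) * moser_power j)"
        by (simp only: moser_coeff_monom sum_distrib_left mult.assoc)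
      finally show ?thesis .
    qed
    then have "?t = (\<Sum>x | weight x \<le> N. \<Sum>j\<in>?J. moser_coeff j (mps_monom x (mps_coeff f x)) * moser_power j)"
      by simp
    also have "\<dots> = (\<Sum>j\<in>?J. moser_coeff j ?t * moser_power j)"
      unfolding moser_coeff_sum sum_distrib_right by (rule sum.swap)
    finally show ?thesis .
  qed
  ultimately have "(f - ?t) - (\<Sum>j\<in>?J. moser_coeff j (f - ?t) * moser_power j)
      = f - (\<Sum>j\<in>?J. moser_coeff j f * moser_power j)"
    by (simp add: moser_coeff_diff left_diff_distrib sum_subtractf)
  with weight_ge_diff[OF d \<open>(\<Sum>j\<in>?J. moser_coeff j (f - ?t) * moser_power j) \<in> weight_ge (Suc N)\<close>]
  show ?thesis by (simp only:)
qed

subsection \<open>Membership in the Moser algebra\<close>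

text \<open>A sufficient condition for membership in the Moser algebra that is linear and passes to
  limits: no small denominator is left and no part is linear in the f_i.\<close>

definition moser_normal :: "'d::{finite,linorder} series \<Rightarrow> bool" where
  "moser_normal h \<longleftrightarrow> (\<forall>x. mps_coeff h x \<noteq> 0 \<longrightarrow> balanced x) \<and>
     (\<forall>i. moser_coeff (Poly_Mapping.single i 1) h = 0)"

lemma total_degree_single [simp]: "total_degree (Poly_Mapping.single i n) = n"
proof -
  have "total_degree (Poly_Mapping.single i n) = (\<Sum>l\<in>UNIV. if i = l then n else 0)"
    unfolding total_degree_def by (rule sum.cong) (auto simp: lookup_single)
  then show ?thesis by simp
qed

lemma total_degree_add: "total_degree (j + l) = total_degree j + total_degree l"
  by (simp add: total_degree_def lookup_add sum.distrib)

lemma total_degree_0 [simp]: "total_degree 0 = 0"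
  by (simp add: total_degree_def)

lemma total_degree_pos_imp_split:
  assumes "total_degree j > 0"
  shows "\<exists>i l. j = Poly_Mapping.single i 1 + l"
proof -
  obtain i where "Poly_Mapping.lookup j i \<noteq> 0"
    using assms unfolding total_degree_def by (metis less_irrefl sum.neutral)
  then have "j = (j - Poly_Mapping.single i 1) + Poly_Mapping.single i 1"
    using add_single_eq_iff[of "j - Poly_Mapping.single i 1" i j] by simp
  then have "j = Poly_Mapping.single i 1 + (j - Poly_Mapping.single i 1)"
    by (simp only: add.commute)
  then show ?thesis by blast
qed

lemma total_degree_less_2:
  assumes "total_degree j < 2" "j \<noteq> 0"
  shows "\<exists>i. j = Poly_Mapping.single i 1"
proof -
  have pos: "total_degree l > 0" if "l \<noteq> 0" for l :: "'a \<Rightarrow>\<^sub>0 nat"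
    using that lookup_le_total_degree[of l] by (metis gr0I le_zero_eq lookup_zero poly_mapping_eqI)
  obtain i l where j: "j = Poly_Mapping.single i 1 + l"
    using total_degree_pos_imp_split[OF pos[OF assms(2)]] by blast
  then have "total_degree l = 0" using assms(1) by (simp add: total_degree_add)
  then have "l = 0" using pos by fastforce
  then show ?thesis using j by auto
qed

lemma moser_normal_zero: "moser_normal 0"
  by (simp add: moser_normal_def zero_mps.rep_eq)

lemma moser_normal_add: "moser_normal f \<Longrightarrow> moser_normal g \<Longrightarrow> moser_normal (f + g)"
  unfolding moser_normal_def moser_coeff_add plus_mps.rep_eq by (metis add.right_neutral)

lemma moser_normal_sum: "(\<And>x. x \<in> A \<Longrightarrow> moser_normal (u x)) \<Longrightarrow> moser_normal (sum u A)"
  by (induction A rule: infinite_finite_induct) (simp_all add: moser_normal_zero moser_normal_add)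

lemma moser_normal_const_mult:
  assumes "moser_normal f"
  shows "moser_normal (mps_const c * f)"
proof -
  have "moser_coeff j (mps_const c * f) = mps_const c * moser_coeff j f" for j
    by (rule mps_eqI) (simp add: mps_coeff_moser_coeff mps_coeff_const_mult sum_distrib_left mult.assoc)
  then show ?thesis using assms by (simp add: moser_normal_def mps_coeff_const_mult)
qed

text \<open>Each coefficient tested by the two conditions depends on finitely many coefficients of
  the series.\<close>

lemma moser_normal_limit:
  assumes "\<And>n. \<exists>g. moser_normal g \<and> f - g \<in> weight_ge n"
  shows "moser_normal f"
  unfolding moser_normal_def
proof (intro conjI allI impI)
  fix x assume x: "mps_coeff f x \<noteq> 0"
  obtain g where "moser_normal g" and g: "f - g \<in> weight_ge (Suc (weight x))"
    using assms by blast
  moreover from weight_geD[OF g, of x] have "mps_coeff g x \<noteq> 0"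
    using x by (simp add: minus_mps.rep_eq)
  ultimately show "balanced x" by (simp add: moser_normal_def)
next
  fix i
  show "moser_coeff (Poly_Mapping.single i 1) f = 0"
  proof (rule weight_ge_eqI)
    fix n
    \<comment> \<open>The extra 2 is the weight lost in extracting a linear coefficient.\<close>
    obtain g where "moser_normal g" and g: "f - g \<in> weight_ge (n + 2)"
      using assms by blast
    with moser_coeff_weight[OF g, of "Poly_Mapping.single i 1"]
    show "moser_coeff (Poly_Mapping.single i 1) f - 0 \<in> weight_ge n"
      by (simp add: moser_normal_def moser_coeff_diff)
  qed
qed

lemma ideal_prod_sum:
  assumes "ideal I (ring_R \<alpha>)" "ideal J (ring_R \<alpha>)" "finite A" "\<And>x. x \<in> A \<Longrightarrow> u x \<in> I \<cdot>\<^bsub>ring_R \<alpha>\<^esub> J"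
  shows "sum u A \<in> I \<cdot>\<^bsub>ring_R \<alpha>\<^esub> J"
  using assms(3,4)
proof (induction A rule: finite_induct)
  case empty
  interpret cring "ring_R \<alpha>" by (rule cring_R)
  interpret ideal "I \<cdot>\<^bsub>ring_R \<alpha>\<^esub> J" "ring_R \<alpha>" by (rule ideal_prod_is_ideal) (rule assms)+
  show ?case using zero_closed by (simp add: ring_R_def)
next
  case (insert x A)
  then have "u x \<oplus>\<^bsub>ring_R \<alpha>\<^esub> sum u A \<in> I \<cdot>\<^bsub>ring_R \<alpha>\<^esub> J"
    by (intro ideal_prod.sum) auto
  then show ?case using insert by (simp add: ring_R_def)
qed

lemma moser_ideal_sq:
  assumes "r \<in> carrier (ring_R \<alpha>)"
  shows "moser_gen i * (moser_gen l * r) \<in> moser_ideal \<alpha> \<cdot>\<^bsub>ring_R \<alpha>\<^esub> moser_ideal \<alpha>"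
proof -
  interpret cring "ring_R \<alpha>" by (rule cring_R)
  have sub: "range moser_gen \<subseteq> carrier (ring_R \<alpha>)" using moser_gen_in_R by blast
  interpret I: ideal "moser_ideal \<alpha>" "ring_R \<alpha>"
    unfolding moser_ideal_def by (rule genideal_ideal[OF sub])
  have gen: "moser_gen k \<in> moser_ideal \<alpha>" for k
    unfolding moser_ideal_def using genideal_self[OF sub] by blast
  have "moser_gen l \<otimes>\<^bsub>ring_R \<alpha>\<^esub> r \<in> moser_ideal \<alpha>"
    by (rule I.I_r_closed[OF gen assms])
  then have "moser_gen i \<otimes>\<^bsub>ring_R \<alpha>\<^esub> (moser_gen l \<otimes>\<^bsub>ring_R \<alpha>\<^esub> r) \<in> moser_ideal \<alpha> \<cdot>\<^bsub>ring_R \<alpha>\<^esub> moser_ideal \<alpha>"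
    by (rule ideal_prod.prod[OF gen])
  then show ?thesis by (simp add: ring_R_def)
qed

text \<open>The expansion has only terms of degree 0, which lie in R_0, and of degree at least 2.
  Elements of the ideal product are finite sums, so the infinite tail is grouped by the finitely
  many products f_i f_l and each cofactor is summed to one series.\<close>

lemma moser_normal_imp_moser_algebra:
  fixes T :: "'d::{finite,linorder} series"
  assumes R: "T \<in> carrier (ring_R \<alpha>)" and normal: "moser_normal T"
  shows "T \<in> moser_algebra \<alpha>"
proof -
  \<comment> \<open>Degree 0 is split off into R_0 and degree 1 vanishes by normality, so both
    receive the coefficient 0 here.\<close>
  define c where "c j = (if total_degree j \<ge> 2 then moser_coeff j T else 0)" for j
  define b where "b = T - moser_coeff 0 T"
  have c0: "c j \<in> ring_R0 \<alpha>" for j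
    by (simp add: c_def ring_R0_moser_coeff R ring_R0_zero)
  have cw: "c j * moser_power j \<in> weight_ge (total_degree j)" for j
    by (rule weight_ge_mono[OF weight_ge_mult[OF weight_ge_0 weight_ge_moser_power]]) simp
  have b: "b - (\<Sum>j | total_degree j \<le> N. c j * moser_power j) \<in> weight_ge (Suc N)" for N
  proof -
    have "moser_coeff j T * moser_power j = (if j = 0 then moser_coeff 0 T else 0) + c j * moser_power j" for j
    proof (cases "total_degree j < 2 \<and> j \<noteq> 0")
      case True
      then obtain i where "j = Poly_Mapping.single i 1" using total_degree_less_2 by blast
      then have "moser_coeff j T = 0" using normal by (simp add: moser_normal_def)
      then show ?thesis using True by (simp add: c_def)
    qed (auto simp: c_def)
    then have "(\<Sum>j | total_degree j \<le> N. moser_coeff j T * moser_power j)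
        = moser_coeff 0 T + (\<Sum>j | total_degree j \<le> N. c j * moser_power j)"
      by (simp add: sum.distrib finite_total_degree_le)
    then show ?thesis
      using moser_expansion[of T N] normal by (simp add: b_def moser_normal_def diff_diff_eq)
  qed
  have "has_formal_sum (\<lambda>j. c j * (\<Prod>i\<in>UNIV. moser_gen i ^ Poly_Mapping.lookup j i)) b"
    unfolding has_formal_sum_def moser_power_def[symmetric]
  proof
    fix m :: "'d var \<Rightarrow>\<^sub>0 nat"
    let ?J = "{j. total_degree j \<le> weight m}" and ?S = "{j. mps_coeff (c j * moser_power j) m \<noteq> 0}"
    have sub: "?S \<subseteq> ?J"
      using weight_geD[OF cw, of m] by (metis (mono_tags, lifting) Collect_mono not_le)
    then have fin: "finite ?S" by (rule finite_subset) (rule finite_total_degree_le)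
    have "mps_coeff b m = (\<Sum>j\<in>?J. mps_coeff (c j * moser_power j) m)"
      using weight_geD[OF b[of "weight m"], of m] by (simp add: mps_coeff_simps)
    also have "\<dots> = (\<Sum>j\<in>?S. mps_coeff (c j * moser_power j) m)"
      by (rule sum.mono_neutral_right) (use sub finite_total_degree_le in auto)
    finally show "finite ?S \<and> mps_coeff b m = (\<Sum>j\<in>?S. mps_coeff (c j * moser_power j) m)"
      using fin by blast
  qed
  then have gens: "b \<in> R0_moser_gens \<alpha>"
    using c0 unfolding R0_moser_gens_def by blast
  \<comment> \<open>Choosing two generators in every power of degree at least 2 assigns each term to
    one group.\<close>
  have "\<exists>i l k. total_degree j \<ge> 2 \<longrightarrow> j = Poly_Mapping.single i 1 + (Poly_Mapping.single l 1 + k)" for j :: "'d \<Rightarrow>\<^sub>0 nat"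
  proof (cases "total_degree j \<ge> 2")
    case True
    then obtain i k where j: "j = Poly_Mapping.single i 1 + k" using total_degree_pos_imp_split[of j] by auto
    then have "total_degree k > 0" using True by (simp add: total_degree_add)
    then obtain l k' where "k = Poly_Mapping.single l 1 + k'" using total_degree_pos_imp_split[of k] by auto
    with j show ?thesis by blast
  qed simp
  then obtain fi fl rest where split: "\<And>j :: 'd \<Rightarrow>\<^sub>0 nat. total_degree j \<ge> 2 \<Longrightarrow>
      j = Poly_Mapping.single (fi j) 1 + (Poly_Mapping.single (fl j) 1 + rest j)" by metis
  \<comment> \<open>The shift by 2 is the degree carried by the two generators, so the remaining
    power has degree \<open>n\<close>.\<close>
  let ?D = "\<lambda>n. {j :: 'd \<Rightarrow>\<^sub>0 nat. total_degree j = n + 2}"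
  have finD: "finite (?D n)" for n
    by (rule finite_subset[OF _ finite_total_degree_le[of "n + 2"]]) auto
  define u where "u y n = (\<Sum>j | j \<in> ?D n \<and> (fi j, fl j) = y. c j * moser_power (rest j))" for y n
  define r where "r y = weight_series (u y)" for y
  have uw: "u y n \<in> weight_ge n" for y n
    unfolding u_def
  proof (intro weight_ge_sum)
    fix j assume "j \<in> {j. j \<in> ?D n \<and> (fi j, fl j) = y}"
    then have j: "total_degree j = n + 2" by simp
    then have "total_degree j = 2 + total_degree (rest j)"
      using arg_cong[OF split[of j], of total_degree] by (simp add: total_degree_add)
    then show "c j * moser_power (rest j) \<in> weight_ge n"
      using j weight_ge_mult[OF weight_ge_0 weight_ge_moser_power[of "rest j"], of "c j"]
      by (auto intro: weight_ge_mono)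
  qed
  have rR: "r y \<in> carrier (ring_R \<alpha>)" for y
    unfolding r_def u_def
    by (intro ring_R_weight_series ring_R_sum ring_R_mult ring_R_moser_power ring_R0_imp_ring_R c0)
  \<comment> \<open>Modulo weight N only the truncated cofactors matter, and their terms are those
    of the expansion of \<open>b\<close> up to degree N + 2.\<close>
  have "b = (\<Sum>y\<in>UNIV. moser_gen (fst y) * (moser_gen (snd y) * r y))"
  proof (rule weight_ge_eqI)
    fix N
    have "moser_gen (fst y) * (moser_gen (snd y) * (r y - (\<Sum>n\<le>N. u y n))) \<in> weight_ge N" for y
      using weight_ge_mult[OF weight_ge_0 weight_ge_mult[OF weight_ge_0 weight_series_approx[of "u y" N, OF uw]],
          of "moser_gen (fst y)" "moser_gen (snd y)"]
      unfolding r_def by (rule weight_ge_mono) simp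
    then have "(\<Sum>y\<in>UNIV. moser_gen (fst y) * (moser_gen (snd y) * (r y - (\<Sum>n\<le>N. u y n)))) \<in> weight_ge N"
      by (intro weight_ge_sum)
    then have 1: "(\<Sum>y\<in>UNIV. moser_gen (fst y) * (moser_gen (snd y) * r y))
        - (\<Sum>y\<in>UNIV. moser_gen (fst y) * (moser_gen (snd y) * (\<Sum>n\<le>N. u y n))) \<in> weight_ge N"
      by (simp add: right_diff_distrib sum_subtractf)
    have "(\<Sum>y\<in>UNIV. moser_gen (fst y) * (moser_gen (snd y) * (\<Sum>n\<le>N. u y n)))
        = (\<Sum>y\<in>UNIV. \<Sum>n\<le>N. \<Sum>j | j \<in> ?D n \<and> (fi j, fl j) = y. c j * moser_power j)"
      unfolding sum_distrib_left u_def
    proof (intro sum.cong refl)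
      fix y n j assume "j \<in> {j. j \<in> ?D n \<and> (fi j, fl j) = y}"
      then have j: "total_degree j \<ge> 2" and y: "fst y = fi j" "snd y = fl j" by auto
      have "moser_power j = moser_gen (fst y) * (moser_gen (snd y) * moser_power (rest j))"
        by (subst split[OF j]) (simp only: moser_power_add moser_power_single y)
      then show "moser_gen (fst y) * (moser_gen (snd y) * (c j * moser_power (rest j))) = c j * moser_power j"
        by (simp add: ac_simps)
    qed
    also have "\<dots> = (\<Sum>n\<le>N. \<Sum>y\<in>UNIV. \<Sum>j | j \<in> ?D n \<and> (fi j, fl j) = y. c j * moser_power j)"
      by (rule sum.swap)
    also have "\<dots> = (\<Sum>n\<le>N. \<Sum>j\<in>?D n. c j * moser_power j)"
      by (intro sum.cong refl sum.group finD) auto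
    also have "\<dots> = (\<Sum>n\<le>N. \<Sum>j | j \<in> {j. total_degree j \<le> N + 2 \<and> 2 \<le> total_degree j} \<and> total_degree j - 2 = n.
        c j * moser_power j)"
      by (intro sum.cong refl) auto
    also have "\<dots> = (\<Sum>j | total_degree j \<le> N + 2 \<and> 2 \<le> total_degree j. c j * moser_power j)"
      by (rule sum.group) (auto intro: finite_subset[OF _ finite_total_degree_le[of "N + 2"]])
    also have "\<dots> = (\<Sum>j | total_degree j \<le> N + 2. c j * moser_power j)"
      by (rule sum.mono_neutral_left) (auto simp: c_def finite_total_degree_le)
    finally have 2: "(\<Sum>j | total_degree j \<le> N + 2. c j * moser_power j)
        = (\<Sum>y\<in>UNIV. moser_gen (fst y) * (moser_gen (snd y) * (\<Sum>n\<le>N. u y n)))" by (rule sym)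
    have "b - (\<Sum>j | total_degree j \<le> N + 2. c j * moser_power j) \<in> weight_ge N"
      by (rule weight_ge_mono[OF b]) simp
    with 1 show "b - (\<Sum>y\<in>UNIV. moser_gen (fst y) * (moser_gen (snd y) * r y)) \<in> weight_ge N"
      unfolding 2 using weight_ge_diff by fastforce
  qed
  moreover have "(\<Sum>y\<in>UNIV. moser_gen (fst y) * (moser_gen (snd y) * r y))
      \<in> moser_ideal \<alpha> \<cdot>\<^bsub>ring_R \<alpha>\<^esub> moser_ideal \<alpha>"
  proof (rule ideal_prod_sum)
    interpret cring "ring_R \<alpha>" by (rule cring_R)
    show "ideal (moser_ideal \<alpha>) (ring_R \<alpha>)" "ideal (moser_ideal \<alpha>) (ring_R \<alpha>)"
      unfolding moser_ideal_def by (rule genideal_ideal, use moser_gen_in_R in blast)+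
  qed (simp_all add: moser_ideal_sq rR)
  ultimately have "b \<in> moser_ideal \<alpha> \<cdot>\<^bsub>ring_R \<alpha>\<^esub> moser_ideal \<alpha> \<inter> R0_moser_gens \<alpha>"
    using gens by simp
  moreover have "moser_coeff 0 T \<in> ring_R0 \<alpha>" by (rule ring_R0_moser_coeff[OF R])
  moreover have "T = moser_coeff 0 T + b" by (simp add: b_def)
  ultimately show ?thesis unfolding moser_algebra_def by blast
qed

section \<open>The homological equation and the normal form\<close>

lemma lookup_eq_0_if_keys_tau:
  assumes "Poly_Mapping.keys x \<subseteq> range TauVar"
  shows "Poly_Mapping.lookup x (QVar i) = 0" "Poly_Mapping.lookup x (PVar i) = 0"
proof -
  have "QVar i \<notin> Poly_Mapping.keys x" "PVar i \<notin> Poly_Mapping.keys x" using assms by auto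
  then show "Poly_Mapping.lookup x (QVar i) = 0" "Poly_Mapping.lookup x (PVar i) = 0"
    by (simp_all add: in_keys_iff)
qed

text \<open>On a monomial in \<tau>, multiplication by p_i q_i = f_i + \<tau>_i produces exactly one
  linear term, in f_i. The general case follows modulo each weight.\<close>

lemma moser_coeff_R0_mult:
  assumes a: "a \<in> ring_R0 \<alpha>"
  shows "moser_coeff (Poly_Mapping.single l 1) (a * (mps_var (PVar i) * mps_var (QVar i))) = (if i = l then a else 0)"
proof (rule weight_ge_eqI)
  fix N
  let ?e = "Poly_Mapping.single l (1::nat)" and ?pq = "mps_var (PVar i) * mps_var (QVar i) :: 'a series"
  let ?t = "\<Sum>x | weight x \<le> N + 2. mps_monom x (mps_coeff a x)"
  have d: "a - ?t \<in> weight_ge (N + 2)"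
    by (rule weight_ge_mono[OF diff_sum_monom_weight_ge]) simp
  have "moser_coeff ?e (mps_monom x (mps_coeff a x) * ?pq) = (if i = l then mps_monom x (mps_coeff a x) else 0)" for x
  proof (cases "mps_coeff a x = 0")
    case True
    then show ?thesis by (simp add: mps_monom_eq_const_mult[of x 0])
  next
    case False
    then have keys: "Poly_Mapping.keys x \<subseteq> range TauVar" using a by (simp add: ring_R0_iff)
    have x0: "Poly_Mapping.lookup x (QVar k) = 0" "Poly_Mapping.lookup x (PVar k) = 0" for k
      using lookup_eq_0_if_keys_tau[OF keys] .
    define y where "y = x + (Poly_Mapping.single (PVar i) 1 + Poly_Mapping.single (QVar i) 1)"
    have y_simps: "Poly_Mapping.lookup y (QVar k) = (if k = i then 1 else 0)"
      "Poly_Mapping.lookup y (PVar k) = (if k = i then 1 else 0)"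
      "Poly_Mapping.lookup y (TauVar k) = Poly_Mapping.lookup x (TauVar k)" for k
      by (simp_all add: y_def lookup_add lookup_single x0 when_def)
    have "mps_monom x (mps_coeff a x) * ?pq = mps_monom y (mps_coeff a x)"
      by (simp add: y_def mps_var_eq_monom mps_monom_mult)
    moreover have "moser_term ?e y = (if i = l then mps_monom x 1 else 0)"
    proof (cases "i = l")
      case True
      have le: "balanced y \<and> (\<forall>k. Poly_Mapping.lookup ?e k \<le> Poly_Mapping.lookup y (QVar k))"
        using True by (simp add: balanced_def y_simps lookup_single when_def)
      show ?thesis
        unfolding moser_term_def if_P[OF le] mps_monom_eq_prod prod_UNIV_var if_P[OF True]
        using True by (intro prod.cong) (auto simp: y_simps lookup_single x0 when_def)
    next
      case False
      then have "\<not> (balanced y \<and> (\<forall>k. Poly_Mapping.lookup ?e k \<le> Poly_Mapping.lookup y (QVar k)))"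
        by (auto simp: y_simps intro!: exI[of _ l])
      then show ?thesis unfolding moser_term_def using False by (simp only: if_False)
    qed
    ultimately show ?thesis
      by (simp add: moser_coeff_monom mps_monom_eq_const_mult[of x "mps_coeff a x"])
  qed
  then have t: "moser_coeff ?e (?t * ?pq) = (if i = l then ?t else 0)"
    by (simp add: sum_distrib_right moser_coeff_sum)
  have "moser_coeff ?e ((a - ?t) * ?pq) \<in> weight_ge (N + 2 - 2)"
    using moser_coeff_weight[OF weight_ge_mult[OF d weight_ge_0[of ?pq]], of ?e] by simp
  then have "moser_coeff ?e (a * ?pq) - (if i = l then ?t else 0) \<in> weight_ge N"
    by (simp only: left_diff_distrib moser_coeff_diff t add_diff_cancel_right')
  moreover have "(if i = l then a else 0) - (if i = l then ?t else 0) \<in> weight_ge N"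
    using weight_ge_mono[OF d, of N] by simp
  ultimately show "moser_coeff ?e (a * ?pq) - (if i = l then a else 0) \<in> weight_ge N"
    using weight_ge_diff[of "moser_coeff ?e (a * ?pq) - (if i = l then ?t else 0)" N
        "(if i = l then a else 0) - (if i = l then ?t else 0)"] by simp
qed

lemma R0_mult_balanced:
  assumes "a \<in> ring_R0 \<alpha>" "mps_coeff (a * (mps_var (PVar i) * mps_var (QVar i))) x \<noteq> 0"
  shows "balanced x"
proof -
  let ?s = "Poly_Mapping.single (PVar i) 1 + Poly_Mapping.single (QVar i) (1::nat)"
  have pq: "a * (mps_var (PVar i) * mps_var (QVar i)) = mps_monom ?s 1 * a"
    by (simp add: mps_var_eq_monom mps_monom_mult mult.commute)
  obtain k where x: "x = ?s + k"
    using assms(2) mps_coeff_monom_mult_not_add[of x ?s 1 a] unfolding pq by blast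
  then have "mps_coeff a k \<noteq> 0" using assms(2) unfolding pq x mps_coeff_monom_mult_add by simp
  then have "Poly_Mapping.keys k \<subseteq> range TauVar" using assms(1) by (simp add: ring_R0_iff)
  note lookup_eq_0_if_keys_tau[OF this]
  then show ?thesis by (simp add: x balanced_def lookup_add lookup_single when_def)
qed

section \<open>Solution of the homological equation\<close>

text \<open>These bounds make the derivation given by the pair raise the weight by \<open>n\<close>;
  membership in R_0 makes it respect the bracket.\<close>

definition admissible :: "('d::{finite,linorder} \<Rightarrow> complex) \<Rightarrow> nat \<Rightarrow> 'd series \<times> ('d \<Rightarrow> 'd series) \<Rightarrow> bool" where
  "admissible \<alpha> n X \<longleftrightarrow> fst X \<in> carrier (ring_R \<alpha>) \<inter> weight_ge (n + 2) \<and> (\<forall>i. snd X i \<in> ring_R0 \<alpha> \<inter> weight_ge n)"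

lemma homological_equation:
  fixes g :: "'d::{finite,linorder} series"
  assumes R: "g \<in> carrier (ring_R \<alpha>)" and w: "g \<in> weight_ge (n + 2)"
  shows "\<exists>X. admissible \<alpha> n X \<and> moser_normal (poisson_derivation (fst X) (snd X) (H0 \<alpha>) + g)"
proof -
  \<comment> \<open>Since the bracket with \<open>H0 \<alpha>\<close> multiplies by the frequency,
    \<open>s\<close> cancels the unbalanced part of \<open>g\<close>, while the \<open>a i\<close>
    below cancel its part linear in f_i.\<close>
  define s where "s = Abs_mps (\<lambda>k. if balanced k then 0 else - mps_coeff g k * (1 / frequency \<alpha> k))"
  define a where "a i = - moser_coeff (Poly_Mapping.single i 1) g" for i
  have s: "mps_coeff s k = (if balanced k then 0 else - mps_coeff g k * (1 / frequency \<alpha> k))" for k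
    by (simp add: s_def Abs_mps_inverse)
  have freq: "frequency \<alpha> k \<noteq> 0" "1 / frequency \<alpha> k \<in> SD \<alpha>" if "\<not> balanced k" for k
  proof -
    have J: "(\<lambda>i. int (Poly_Mapping.lookup k (PVar i)) - int (Poly_Mapping.lookup k (QVar i))) \<noteq> (\<lambda>i. 0)"
      using that unfolding balanced_def by (metis diff_eq_diff_eq diff_self of_nat_eq_iff)
    show "frequency \<alpha> k \<noteq> 0" unfolding frequency_def by (rule small_denominator_nonzero[OF J])
    show "1 / frequency \<alpha> k \<in> SD \<alpha>" unfolding frequency_def by (rule SD.small_denominator[OF J])
  qed
  have "s \<in> carrier (ring_R \<alpha>)"
    using R by (auto simp: ring_R_iff s SD_0 simp del: mult_minus_left times_divide_eq_right intro!: SD.mult SD_uminus freq)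
  moreover have "s \<in> weight_ge (n + 2)"
    using w by (simp add: weight_ge_def s)
  moreover have aR: "a i \<in> ring_R0 \<alpha>" for i
    by (simp add: a_def ring_R0_uminus ring_R0_moser_coeff R)
  moreover have "a i \<in> weight_ge n" for i
    using moser_coeff_weight[OF w, of "Poly_Mapping.single i 1"] by (simp add: a_def weight_ge_uminus)
  ultimately have adm: "admissible \<alpha> n (s, a)" by (simp add: admissible_def)
  let ?v = "poisson_bracket (H0 \<alpha>) s + g" and ?A = "\<Sum>i\<in>UNIV. a i * (mps_var (PVar i) * mps_var (QVar i))"
  have D: "poisson_derivation s a (H0 \<alpha>) + g = ?v + ?A"
    by (simp add: poisson_derivation_def omega_deriv_H0)
  have v: "mps_coeff ?v x = (if balanced x then mps_coeff g x else 0)" for x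
    using freq(1)[of x] by (simp add: plus_mps.rep_eq mps_coeff_poisson_bracket_H0 s)
  have "moser_normal (?v + ?A)"
    unfolding moser_normal_def
  proof (intro conjI allI impI)
    fix x assume x: "mps_coeff (?v + ?A) x \<noteq> 0"
    show "balanced x"
    proof (rule ccontr)
      assume nb: "\<not> balanced x"
      then have "mps_coeff (a i * (mps_var (PVar i) * mps_var (QVar i))) x = 0" for i
        using R0_mult_balanced[OF aR] by blast
      moreover have "mps_coeff ?v x = 0" using nb by (simp only: v if_False)
      ultimately have "mps_coeff (?v + ?A) x = 0" by (simp only: plus_mps.rep_eq mps_coeff_sum) simp
      with x show False by contradiction
    qed
  next
    fix l
    have "moser_coeff (Poly_Mapping.single l 1) ?v = moser_coeff (Poly_Mapping.single l 1) g"
      by (rule moser_coeff_balanced_cong) (simp only: v if_True)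
    moreover have "moser_coeff (Poly_Mapping.single l 1) ?A = a l"
      unfolding moser_coeff_sum moser_coeff_R0_mult[OF aR] by simp
    ultimately show "moser_coeff (Poly_Mapping.single l 1) (?v + ?A) = 0"
      by (simp add: moser_coeff_add a_def)
  qed
  with adm D show ?thesis by (metis fst_conv snd_conv)
qed

section \<open>Recursive choice of the derivations\<close>

definition derivations :: "(nat \<Rightarrow> 'd::{finite,linorder} series \<times> ('d \<Rightarrow> 'd series)) \<Rightarrow> nat \<Rightarrow> 'd series \<Rightarrow> 'd series" where
  "derivations X k = poisson_derivation (fst (X k)) (snd (X k))"

lemma weight_raising_derivations_derivations:
  assumes "\<And>k. admissible \<alpha> k (X k)"
  shows "weight_raising_derivations \<alpha> (derivations X)"
proof
  have X: "fst (X k) \<in> carrier (ring_R \<alpha>)" "fst (X k) \<in> weight_ge (k + 2)"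
    "snd (X k) i \<in> ring_R0 \<alpha>" "snd (X k) i \<in> weight_ge k" for k i
    using assms[of k] by (auto simp: admissible_def)
  fix k
  show "derivations X k f \<in> weight_ge (m + k)" if "f \<in> weight_ge m" for f m
    unfolding derivations_def by (rule weight_ge_poisson_derivation[OF X(2) X(4) that])
  show "derivations X k f \<in> carrier (ring_R \<alpha>)" if "f \<in> carrier (ring_R \<alpha>)" for f
    unfolding derivations_def by (rule ring_R_poisson_derivation[OF X(1) ring_R0_imp_ring_R[OF X(3)] that])
  show "derivations X k (poisson_bracket f g)
      = poisson_bracket (derivations X k f) g + poisson_bracket f (derivations X k g)" for f g
    unfolding derivations_def by (rule poisson_derivation_bracket[OF X(3)])
qed (simp_all add: derivations_def poisson_derivation_add poisson_derivation_mult poisson_derivation_scalar)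

lemma admissible_zero: "admissible \<alpha> n (0, \<lambda>_. 0)"
  by (simp add: admissible_def ring_R_zero ring_R0_zero)

text \<open>\<open>n\<close> times the part of degree \<open>n\<close> of the transform of \<open>H0 \<alpha> + t G\<close> which does not involve \<open>D n\<close>.\<close>

definition known_part :: "('d::{finite,linorder} \<Rightarrow> complex) \<Rightarrow> 'd series \<Rightarrow> (nat \<Rightarrow> 'd series \<Rightarrow> 'd series) \<Rightarrow> nat \<Rightarrow> 'd series" where
  "known_part \<alpha> G D n = (\<Sum>k<n - 1. path_exp D (n - Suc k) (D (Suc k) (H0 \<alpha>))) + of_nat n * path_exp D (n - 1) G"

text \<open>Only derivations of index below \<open>n\<close> enter, so the recursion for
  \<open>D n\<close> is well-founded.\<close>

lemma known_part_cong:
  assumes "\<And>k. k < n \<Longrightarrow> D k = D' k"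
  shows "known_part \<alpha> G D n = known_part \<alpha> G D' n"
proof -
  have "path_exp D m f = path_exp D' m f" if "m < n" for m f
    using assms that by (intro path_exp_cong) simp
  moreover have "D (Suc k) = D' (Suc k)" if "k < n - 1" for k
    using assms that by simp
  moreover have "n - 1 < n \<or> n = 0" by auto
  ultimately show ?thesis
    unfolding known_part_def by (intro arg_cong2[of _ _ _ _ "(+)"] sum.cong) auto
qed

lemma exists_derivations:
  assumes G: "G \<in> carrier (ring_R \<alpha>)" "G \<in> weight_ge 3"
  shows "\<exists>X. \<forall>n. admissible \<alpha> n (X n) \<and>
    (n > 0 \<longrightarrow> moser_normal (derivations X n (H0 \<alpha>) + known_part \<alpha> G (derivations X) n))"
proof -
  \<comment> \<open>Entries not yet chosen are replaced by the zero derivation. The cut sequence is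
    admissible throughout, so all results on the exponential apply to it.\<close>
  define cut where "cut X n k = (if k < n then X k else (0, \<lambda>_. 0))"
    for X :: "nat \<Rightarrow> 'a series \<times> ('a \<Rightarrow> 'a series)" and n k :: nat
  define Q where "Q X n r \<longleftrightarrow> admissible \<alpha> n r \<and>
      (n > 0 \<longrightarrow> moser_normal (poisson_derivation (fst r) (snd r) (H0 \<alpha>) + known_part \<alpha> G (derivations (cut X n)) n))" for X n r
  have "\<exists>X. \<forall>n. Q X n (X n)"
  proof (rule dependent_wf_choice[OF wf_less_than])
    fix f g :: "nat \<Rightarrow> 'a series \<times> ('a \<Rightarrow> 'a series)" and n r
    assume "\<And>z. (z, n) \<in> less_than \<Longrightarrow> f z = g z"
    then have "cut f n = cut g n" by (auto simp: cut_def)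
    then show "Q f n r = Q g n r" by (simp add: Q_def)
  next
    fix n and X :: "nat \<Rightarrow> 'a series \<times> ('a \<Rightarrow> 'a series)"
    assume "\<And>y. (y, n) \<in> less_than \<Longrightarrow> Q X y (X y)"
    then have "admissible \<alpha> k (cut X n k)" for k
      by (auto simp: cut_def Q_def admissible_zero)
    then interpret weight_raising_derivations \<alpha> "derivations (cut X n)"
      by (rule weight_raising_derivations_derivations)
    let ?g = "known_part \<alpha> G (derivations (cut X n)) n"
    show "\<exists>r. Q X n r"
    proof (cases "n = 0")
      case True
      then show ?thesis using admissible_zero[of \<alpha> 0] by (auto simp: Q_def)
    next
      case False
      \<comment> \<open>\<open>H0 \<alpha>\<close> has weight 2, while \<open>G\<close> has weight 3
        but carries one factor t. In degree n both reach the weight n + 2 = 3 + (n - 1).\<close>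
      have "H0 \<alpha> \<in> weight_ge 2"
        unfolding H0_def
        using weight_ge_mult[OF weight_ge_mult[OF weight_ge_0 weight_ge_var[of "PVar _"]] weight_ge_var[of "QVar _"]]
        by (intro weight_ge_sum) (simp add: numeral_2_eq_2)
      then have "P (n - Suc k) (derivations (cut X n) (Suc k) (H0 \<alpha>)) \<in> weight_ge (n + 2)" if "k < n - 1" for k
        using P_weight[OF D_weight, of "H0 \<alpha>" 2 "n - Suc k" "Suc k"] that by simp
      moreover have "P (n - 1) G \<in> weight_ge (n + 2)"
        using P_weight[OF G(2), of "n - 1"] False by simp
      ultimately have "?g \<in> weight_ge (n + 2)"
        unfolding known_part_def of_nat_eq_mps_const
        by (intro weight_ge_add weight_ge_sum weight_ge_const_mult) simp_all
      moreover have "?g \<in> carrier (ring_R \<alpha>)"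
        unfolding known_part_def
        by (intro ring_R_add ring_R_sum ring_R_mult P_R D_R ring_R_H0 G ring_R0_imp_ring_R ring_R0_of_nat)
      ultimately show ?thesis unfolding Q_def using homological_equation[of ?g \<alpha> n] by blast
    qed
  qed
  then obtain X where X: "\<And>n. Q X n (X n)" by blast
  have "known_part \<alpha> G (derivations (cut X n)) n = known_part \<alpha> G (derivations X) n" for n
    by (rule known_part_cong) (simp add: derivations_def cut_def)
  then show ?thesis using X unfolding Q_def derivations_def by (intro exI[of _ X]) simp
qed

theorem theorem2p9:
  fixes \<alpha> :: "'d::{finite,linorder} \<Rightarrow> complex"
    and F :: "'d series"
  assumes "nonresonant \<alpha>"
    and "F \<in> carrier (ring_R \<alpha>)"
    and "F - H0 \<alpha> \<in> bigO \<alpha> 3"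
  shows "\<exists>\<Phi>. poisson_automorphism \<alpha> \<Phi> \<and>
           (\<exists>T \<in> moser_algebra \<alpha>. \<Phi> F = H0 \<alpha> + T)"
proof -
  define G where "G = F - H0 \<alpha>"
  have G: "G \<in> carrier (ring_R \<alpha>)" "G \<in> weight_ge 3"
    using assms(3) by (auto simp: G_def bigO_def weight_ge_def linorder_not_le[symmetric])
  obtain X where X: "\<And>n. admissible \<alpha> n (X n)"
    and normal: "\<And>n. n > 0 \<Longrightarrow> moser_normal (derivations X n (H0 \<alpha>) + known_part \<alpha> G (derivations X) n)"
    using exists_derivations[OF G] by blast
  interpret weight_raising_derivations \<alpha> "derivations X"
    using X by (rule weight_raising_derivations_derivations)
  \<comment> \<open>The part of degree n + 1 of the transform of \<open>H0 \<alpha>\<close> + t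
    \<open>G\<close>, where \<open>G\<close> counts one degree higher.\<close>
  let ?m = "\<lambda>n. P (Suc n) (H0 \<alpha>) + P n G"
  have m: "moser_normal (?m n)" for n
  proof -
    \<comment> \<open>The last summand of the recursion for \<open>H0 \<alpha>\<close> is
      \<open>P 0\<close> applied to the newest derivation; all the rest is the known part.\<close>
    have "of_nat (Suc n) * ?m n = derivations X (Suc n) (H0 \<alpha>) + known_part \<alpha> G (derivations X) (Suc n)"
      unfolding distrib_left path_exp_rec known_part_def by (simp add: ac_simps)
    then have "(of_nat (Suc n) * nat_inverse (Suc n)) * ?m n
        = nat_inverse (Suc n) * (derivations X (Suc n) (H0 \<alpha>) + known_part \<alpha> G (derivations X) (Suc n))"
      by (simp only: mult.assoc mult.left_commute[of "of_nat (Suc n)"])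
    then have "?m n = nat_inverse (Suc n) * (derivations X (Suc n) (H0 \<alpha>) + known_part \<alpha> G (derivations X) (Suc n))"
      by (simp only: of_nat_mult_nat_inverse zero_less_Suc mult_1_left)
    then show ?thesis using moser_normal_const_mult[OF normal[of "Suc n"]] by simp
  qed
  define T where "T = path_automorphism F - H0 \<alpha>"
  have "moser_normal T"
  proof (rule moser_normal_limit)
    fix N
    have "(\<Sum>n\<le>N. P n F) = (\<Sum>n\<le>N. P n (H0 \<alpha>)) + (\<Sum>n\<le>N. P n G)"
      using P_add[of _ "H0 \<alpha>" G] by (simp add: G_def sum.distrib)
    also have "(\<Sum>n\<le>N. P n (H0 \<alpha>)) = H0 \<alpha> + (\<Sum>n<N. P (Suc n) (H0 \<alpha>))"
      by (simp add: sum.atMost_shift)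
    also have "(\<Sum>n\<le>N. P n G) = (\<Sum>n<N. P n G) + P N G"
      by (simp add: lessThan_Suc_atMost[symmetric])
    \<comment> \<open>The degree shift between \<open>H0 \<alpha>\<close> and \<open>G\<close>
      leaves \<open>P N G\<close> over, which has weight at least N + 3.\<close>
    finally have "T - (\<Sum>n<N. ?m n) = (path_automorphism F - (\<Sum>n\<le>N. P n F)) + P N G"
      by (simp add: T_def sum.distrib)
    also have "\<dots> \<in> weight_ge N"
      using path_automorphism_approx[of F N] P_weight[OF G(2), of N]
      by (intro weight_ge_add) (auto intro: weight_ge_mono)
    finally show "\<exists>g. moser_normal g \<and> T - g \<in> weight_ge N"
      using moser_normal_sum[of "{..<N}" ?m] m by blast
  qed
  moreover have "T \<in> carrier (ring_R \<alpha>)"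
    unfolding T_def by (intro ring_R_diff path_automorphism_R assms ring_R_H0)
  ultimately have "T \<in> moser_algebra \<alpha>" by (intro moser_normal_imp_moser_algebra)
  moreover have "path_automorphism F = H0 \<alpha> + T" by (simp add: T_def)
  ultimately show ?thesis using poisson_automorphism_path_automorphism by blast
qed

end
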